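(* Let $0 \le p \le 1$, let $\rho_0,\rho_1$ be density operators (quantum states, possibly mixed) on a finite-dimensional complex Hilbert space $\mathbb{C}^d$ ($d$ arbitrary), and let $\mathcal{E} = \{(p,\rho_0),(1-p,\rho_1)\}$. Then $$\mathrm{I}_{\mathrm{acc}}(\mathcal{E}) \;\ge\; \mathrm{H}(p) - \sqrt{4p(1-p) - \chi(\mathcal{E})^2},$$ and $$\mathrm{I}_{\mathrm{acc}}(\mathcal{E}) \;\ge\; -\log_2\left[ p^2 + (1-p)^2 + 2p(1-p)\left\{1 - \frac{\chi(\mathcal{E})^2}{4p(1-p)}\right\}^{1/2}\right],$$ where, if $p\in\{0,1\}$, the term $2p(1-p)\{\cdots\}^{1/2}$ is read as $0$.
   Context: All logarithms are to base $2$, with the convention $0\log_2 0 = 0$. The binary entropy function is $\mathrm{H}(p) = -p\log_2 p - (1-p)\log_2(1-p)$ for $0\le p\le 1$. The von Neumann entropy of a density operator $\rho$ is $\mathrm{S}(\rho) = -\mathrm{Tr}(\rho\log_2\rho)$. Ensemble: $\mathcal{E} = \{(p,\rho_0),(1-p,\rho_1)\}$ corresponds to a random variable $X$ with $\Pr(X=0)=p$, $\Pr(X=1)=1-p$, together with an encoding $M$ of $X$ into quantum states such that $M=\rho_i$ when $X=i$. Holevo information: $\chi(\mathcal{E}) = \mathrm{S}(p\rho_0+(1-p)\rho_1) - p\,\mathrm{S}(\rho_0) - (1-p)\,\mathrm{S}(\rho_1)$. Accessible information: for a POVM $\mathcal{M}=\{E_m\}$ on $\mathbb{C}^d$ (finitely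 many positive semidefinite operators summing to the identity), let $Y^{\mathcal{M}}$ be the random outcome of measuring $M$, i.e. $\Pr(Y^{\mathcal{M}}=m \mid X=i) = \mathrm{Tr}(E_m\rho_i)$. Then $\mathrm{I}_{\mathrm{acc}}(\mathcal{E}) = \max_{\mathcal{M}} \mathrm{I}(X:Y^{\mathcal{M}})$, where the maximum (equivalently, supremum) is over all POVMs $\mathcal{M}$ and $\mathrm{I}(X:Y)$ is the (Shannon) mutual information in bits. *)

theory Defs
  imports "HOL-Probability.Probability"
begin

section \<open>States and measurements on \<open>\<complex>\<^sup>d\<close>\<close>

definition cadjoint :: "complex ^ 'n ^ 'm \<Rightarrow> complex ^ 'm ^ 'n" where
  "cadjoint A = map_matrix cnj (transpose A)"

definition positive_semidef :: "complex ^ 'd ^ 'd \<Rightarrow> bool" where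
  "positive_semidef A \<longleftrightarrow>
     cadjoint A = A \<and> (\<forall>v. 0 \<le> Re (\<Sum>i\<in>UNIV. cnj (v $ i) * (A *v v) $ i))"

definition density_operator :: "complex ^ 'd ^ 'd \<Rightarrow> bool" where
  "density_operator \<rho> \<longleftrightarrow> positive_semidef \<rho> \<and> trace \<rho> = 1"

text \<open>A POVM with \<open>n\<close> outcomes, labelled \<open>0, \<dots>, n - 1\<close>.\<close>

definition povm :: "nat \<Rightarrow> (nat \<Rightarrow> complex ^ 'd ^ 'd) \<Rightarrow> bool" where
  "povm n E \<longleftrightarrow> (\<forall>m<n. positive_semidef (E m)) \<and> (\<Sum>m<n. E m) = mat 1"


section \<open>Von Neumann entropy\<close>

definition unitary :: "complex ^ 'd ^ 'd \<Rightarrow> bool" where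
  "unitary U \<longleftrightarrow> cadjoint U ** U = mat 1 \<and> U ** cadjoint U = mat 1"

definition real_diag :: "('d \<Rightarrow> real) \<Rightarrow> complex ^ 'd ^ 'd" where
  "real_diag l = (\<chi> i j. if i = j then complex_of_real (l i) else 0)"

text \<open>
  Functional calculus \<open>f(A) = U diag(f(l)) U\<^sup>*\<close> for Hermitian \<open>A = U diag(l) U\<^sup>*\<close>. The result does
  not depend on the diagonalization chosen: see \<open>matrix_function_diag\<close> below.
\<close>

definition matrix_function :: "(real \<Rightarrow> real) \<Rightarrow> complex ^ 'd ^ 'd \<Rightarrow> complex ^ 'd ^ 'd" where
  "matrix_function f A = (THE B. \<exists>U l. unitary U \<and>
     A = U ** real_diag l ** cadjoint U \<and> B = U ** real_diag (f \<circ> l) ** cadjoint U)"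

text \<open>
  \<^term>\<open>log 2 0\<close> is a (finite) real number, so zero eigenvalues of \<open>\<rho>\<close> contribute \<open>0\<close>, as the
  convention \<open>0 log 0 = 0\<close> demands.
\<close>

definition von_neumann_entropy :: "complex ^ 'd ^ 'd \<Rightarrow> real" where
  "von_neumann_entropy \<rho> = - Re (trace (\<rho> ** matrix_function (log 2) \<rho>))"


section \<open>The ensemble \<open>{(p, \<rho>\<^sub>0), (1 - p, \<rho>\<^sub>1)}\<close>\<close>

definition binary_entropy :: "real \<Rightarrow> real" where
  "binary_entropy p = - p * log 2 p - (1 - p) * log 2 (1 - p)"

definition holevo_information :: "real \<Rightarrow> complex ^ 'd ^ 'd \<Rightarrow> complex ^ 'd ^ 'd \<Rightarrow> real" where
  "holevo_information p \<rho>0 \<rho>1 =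
     von_neumann_entropy (p *\<^sub>R \<rho>0 + (1 - p) *\<^sub>R \<rho>1)
     - p * von_neumann_entropy \<rho>0 - (1 - p) * von_neumann_entropy \<rho>1"

text \<open>
  The weights \<open>Tr (E\<^sub>m \<rho>)\<close> are nonnegative reals summing to \<open>Tr \<rho> = 1\<close> if \<open>E\<close> is a POVM and \<open>\<rho>\<close> is a
  density operator; only then is \<^const>\<open>embed_pmf\<close> meaningful.
\<close>

definition outcome_pmf :: "nat \<Rightarrow> (nat \<Rightarrow> complex ^ 'd ^ 'd) \<Rightarrow> complex ^ 'd ^ 'd \<Rightarrow> nat pmf" where
  "outcome_pmf n E \<rho> = embed_pmf (\<lambda>m. if m < n then Re (trace (E m ** \<rho>)) else 0)"

text \<open>
  The joint distribution of \<open>(X, Y)\<close>. The value \<open>X = 0\<close> is represented by \<^const>\<open>False\<close> and \<open>X = 1\<close>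
  by \<^const>\<open>True\<close>, so that \<open>X\<close> is Bernoulli with success probability \<open>1 - p\<close>.
\<close>

definition measurement_pmf ::
    "real \<Rightarrow> complex ^ 'd ^ 'd \<Rightarrow> complex ^ 'd ^ 'd \<Rightarrow> nat \<Rightarrow> (nat \<Rightarrow> complex ^ 'd ^ 'd)
     \<Rightarrow> (bool \<times> nat) pmf" where
  "measurement_pmf p \<rho>0 \<rho>1 n E =
     bind_pmf (bernoulli_pmf (1 - p))
       (\<lambda>x. map_pmf (Pair x) (outcome_pmf n E (if x then \<rho>1 else \<rho>0)))"

text \<open>
  Shannon mutual information, in bits, of the two components of a joint distribution. For finite
  support it is the usual sum: see \<open>pmf_mutual_information_eq_sum\<close> below.
\<close>

definition pmf_mutual_information :: "('a \<times> 'b) pmf \<Rightarrow> real" where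
  "pmf_mutual_information J =
     prob_space.mutual_information (measure_pmf J) 2 (count_space UNIV) (count_space UNIV) fst snd"

text \<open>
  The supremum is over a nonempty family which is bounded above by the entropy of \<open>X\<close>, so the
  conditionally complete supremum on the reals is the true one.
\<close>

definition accessible_information :: "real \<Rightarrow> complex ^ 'd ^ 'd \<Rightarrow> complex ^ 'd ^ 'd \<Rightarrow> real" where
  "accessible_information p \<rho>0 \<rho>1 =
     (SUP (n, E)\<in>{(n, E). povm n E}. pmf_mutual_information (measurement_pmf p \<rho>0 \<rho>1 n E))"


section \<open>Well-definedness\<close>

lemma real_diag_mult_nth: "(A ** real_diag l) $ i $ j = A $ i $ j * complex_of_real (l j)"
  by (simp add: matrix_matrix_mult_def real_diag_def if_distrib cong: if_cong)

lemma mult_real_diag_nth: "(real_diag l ** A) $ i $ j = complex_of_real (l i) * A $ i $ j"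
  by (simp add: matrix_matrix_mult_def real_diag_def if_distrib[of "\<lambda>z. z * _"] cong: if_cong)

lemma matrix_function_diag:
  assumes U: "unitary U"
  shows "matrix_function f (U ** real_diag l ** cadjoint U) =
           U ** real_diag (f \<circ> l) ** cadjoint U"
  unfolding matrix_function_def
proof (rule the_equality)
  fix B
  assume "\<exists>V k. unitary V \<and> U ** real_diag l ** cadjoint U = V ** real_diag k ** cadjoint V \<and>
            B = V ** real_diag (f \<circ> k) ** cadjoint V"
  then obtain V k where V: "unitary V"
    and eq: "U ** real_diag l ** cadjoint U = V ** real_diag k ** cadjoint V"
    and B: "B = V ** real_diag (f \<circ> k) ** cadjoint V" by blast
  define W where "W = cadjoint V ** U"
  have UU: "cadjoint U ** U = mat 1" "U ** cadjoint U = mat 1"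
    and VV: "cadjoint V ** V = mat 1" "V ** cadjoint V = mat 1"
    using U V by (auto simp: unitary_def)
  have "W ** real_diag l = cadjoint V ** (U ** real_diag l ** cadjoint U) ** U"
    unfolding W_def by (metis UU(1) matrix_mul_assoc matrix_mul_rid)
  also have "\<dots> = real_diag k ** W"
    unfolding eq W_def by (metis VV(1) matrix_mul_assoc matrix_mul_lid)
  finally have "W ** real_diag l = real_diag k ** W" .
  then have "W $ i $ j * complex_of_real (l j) = complex_of_real (k i) * W $ i $ j" for i j
    by (metis real_diag_mult_nth mult_real_diag_nth)
  then have "W $ i $ j = 0 \<or> l j = k i" for i j
    by (metis mult.commute mult_left_cancel of_real_eq_iff)
  then have W: "W ** real_diag (f \<circ> l) = real_diag (f \<circ> k) ** W"
    unfolding vec_eq_iff real_diag_mult_nth mult_real_diag_nth by (metis comp_apply mult.commute mult_zero_left)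
  have "B = V ** (real_diag (f \<circ> k) ** W) ** cadjoint U"
    unfolding B W_def by (metis UU(2) matrix_mul_assoc matrix_mul_rid)
  also have "\<dots> = U ** real_diag (f \<circ> l) ** cadjoint U"
    unfolding W[symmetric] unfolding W_def by (metis VV(2) matrix_mul_assoc matrix_mul_lid)
  finally show "B = U ** real_diag (f \<circ> l) ** cadjoint U" .
qed (use U in blast)

lemma pmf_mutual_information_eq_sum:
  fixes J :: "('a::countable \<times> 'b::countable) pmf"
  assumes "finite (set_pmf J)"
  shows "pmf_mutual_information J =
    (\<Sum>(x, y)\<in>set_pmf J. pmf J (x, y) *
       log 2 (pmf J (x, y) / (pmf (map_pmf fst J) x * pmf (map_pmf snd J) y)))"
proof -
  interpret information_space "measure_pmf J" 2 by unfold_locales simp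
  have distributed: "distributed (measure_pmf J) (count_space UNIV) f (pmf (map_pmf f J))" for f :: "_ \<Rightarrow> 'c::countable"
    unfolding distributed_def map_pmf_rep_eq[symmetric]
    by (auto simp: measure_pmf_eq_density)
  let ?C = "count_space UNIV :: ('a \<times> 'b) measure"
  have prod: "count_space UNIV \<Otimes>\<^sub>M count_space UNIV = ?C"
    using pair_measure_countable[of "UNIV::'a set" "UNIV::'b set"] by simp
  have "pmf_mutual_information J = (\<integral>z. pmf J z *
      log 2 (pmf J z / (pmf (map_pmf fst J) (fst z) * pmf (map_pmf snd J) (snd z))) \<partial>?C)"
    unfolding pmf_mutual_information_def prod[symmetric]
    by (rule mutual_information_distr)
       (use distributed[of fst] distributed[of snd] distributed[of id] in
        \<open>auto simp: prod id_def sigma_finite_measure_count_space_countable\<close>)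
  also have "\<dots> = (\<Sum>z\<in>set_pmf J. pmf J z *
      log 2 (pmf J z / (pmf (map_pmf fst J) (fst z) * pmf (map_pmf snd J) (snd z))))"
    by (subst lebesgue_integral_count_space_finite_support)
       (auto intro!: sum.mono_neutral_left assms finite_subset[OF _ assms] simp: set_pmf_iff)
  finally show ?thesis by (simp add: case_prod_unfold)
qed

end

theory Submission
  imports Defs "HOL-Real_Asymp.Real_Asymp"
begin

text \<open>
  Let \<open>\<rho>\<^sub>0 = A A\<^sup>*\<close> and \<open>\<rho>\<^sub>1 = B B\<^sup>*\<close>, where \<open>A\<close> and \<open>B\<close> are chosen such that the measurement in some
  orthonormal basis produces outcome distributions whose classical fidelity is \<open>f = Re Tr (A\<^sup>* B)\<close>
  (Fuchs and Caves). Regarding \<open>A\<close> and \<open>B\<close> as purifications, data processing bounds \<open>\<chi>\<close> by the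
  entropy \<open>H(\<lambda>)\<close> of the pure-state ensemble, where \<open>\<lambda> (1 - \<lambda>) = p (1 - p) (1 - f\<^sup>2)\<close>; since
  \<open>H(\<lambda>) \<le> 2 \<surd>(\<lambda> (1 - \<lambda>))\<close>, this yields \<open>\<chi>\<^sup>2 \<le> 4 p (1 - p) (1 - f\<^sup>2)\<close>. The mutual information of the
  measurement is at least \<open>H(p) - 2 \<surd>(p (1 - p)) f\<close>, by the same inequality for \<open>H\<close> applied to the
  posterior of \<open>X\<close>, and at least \<open>- log (p\<^sup>2 + (1 - p)\<^sup>2 + 2 p (1 - p) f)\<close>, by Jensen's inequality.

  Data processing is proved at the level of resolvents: relative entropies are integrals over \<open>u\<close>
  of \<open>Re Tr (Y\<^sup>* \<rho>)\<close> with \<open>\<sigma> Y + u Y \<rho> = \<rho>\<close>, and restricting to the span of the purifications only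
  increases this quantity.
\<close>

section \<open>Complex matrices\<close>

lemma cadjoint_nth [simp]: "cadjoint A $ i $ j = cnj (A $ j $ i)"
  by (simp add: cadjoint_def map_matrix_def transpose_def)

lemma cadjoint_cadjoint [simp]: "cadjoint (cadjoint A) = A"
  by (simp add: vec_eq_iff)

lemma cadjoint_mult: "cadjoint (A ** B) = cadjoint B ** cadjoint A"
  by (simp add: vec_eq_iff matrix_matrix_mult_def mult.commute)

lemma cadjoint_mat_1 [simp]: "cadjoint (mat 1) = mat 1"
  by (simp add: vec_eq_iff mat_def)

lemma cadjoint_real_diag [simp]: "cadjoint (real_diag l) = real_diag l"
  by (auto simp: vec_eq_iff real_diag_def)

lemma real_diag_mult: "real_diag k ** real_diag l = real_diag (\<lambda>i. k i * l i)"
  unfolding vec_eq_iff mult_real_diag_nth by (simp add: real_diag_def)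

lemma real_diag_1 [simp]: "real_diag (\<lambda>_. 1) = mat 1"
  by (simp add: real_diag_def mat_def vec_eq_iff)

lemma inner_complex_vec: "x \<bullet> y = Re (\<Sum>i\<in>UNIV. cnj (x $ i) * y $ i)" for x y :: "complex ^ 'n"
  by (simp add: inner_vec_def inner_complex_def)

text \<open>Hence the type-class inner product on matrices is \<open>Re (Tr (X\<^sup>* Y))\<close>
  and \<open>norm\<close> is the Hilbert-Schmidt norm; most traces below are computed through
  it.\<close>

lemma inner_complex_matrix: "X \<bullet> Y = Re (\<Sum>i\<in>UNIV. \<Sum>j\<in>UNIV. cnj (X $ i $ j) * Y $ i $ j)"
  for X Y :: "complex ^ 'n ^ 'm"
  by (simp add: inner_vec_def inner_complex_def)

lemma inner_cadjoint: "cadjoint X \<bullet> cadjoint Y = X \<bullet> Y"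
  unfolding inner_complex_matrix
  by (subst sum.swap) (simp add: mult.commute)

lemma norm_cadjoint [simp]: "norm (cadjoint X) = norm X"
  by (simp add: norm_eq_sqrt_inner inner_cadjoint)

lemma inner_mult_left: "(X ** Y) \<bullet> Z = Y \<bullet> (cadjoint X ** Z)"
  for X :: "complex ^ 'n ^ 'm"
proof -
  have "(X ** Y) \<bullet> Z = Re (\<Sum>i\<in>UNIV. \<Sum>j\<in>UNIV. \<Sum>k\<in>UNIV. cnj (X $ i $ k) * cnj (Y $ k $ j) * Z $ i $ j)"
    by (simp add: inner_complex_matrix matrix_matrix_mult_def sum_distrib_right)
  also have "\<dots> = Re (\<Sum>i\<in>UNIV. \<Sum>k\<in>UNIV. \<Sum>j\<in>UNIV. cnj (X $ i $ k) * cnj (Y $ k $ j) * Z $ i $ j)"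
    by (rule arg_cong[where f = Re], rule sum.cong[OF refl], rule sum.swap)
  also have "\<dots> = Re (\<Sum>k\<in>UNIV. \<Sum>i\<in>UNIV. \<Sum>j\<in>UNIV. cnj (X $ i $ k) * cnj (Y $ k $ j) * Z $ i $ j)"
    by (rule arg_cong[where f = Re], rule sum.swap)
  also have "\<dots> = Re (\<Sum>k\<in>UNIV. \<Sum>j\<in>UNIV. \<Sum>i\<in>UNIV. cnj (X $ i $ k) * cnj (Y $ k $ j) * Z $ i $ j)"
    by (rule arg_cong[where f = Re], rule sum.cong[OF refl], rule sum.swap)
  also have "\<dots> = Y \<bullet> (cadjoint X ** Z)"
    by (simp add: inner_complex_matrix matrix_matrix_mult_def sum_distrib_left mult_ac)
  finally show ?thesis .
qed

lemma inner_mult_right: "(X ** Y) \<bullet> Z = X \<bullet> (Z ** cadjoint Y)"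
proof -
  have "(X ** Y) \<bullet> Z = (cadjoint Y ** cadjoint X) \<bullet> cadjoint Z"
    by (simp only: inner_cadjoint cadjoint_mult[symmetric])
  also have "\<dots> = cadjoint X \<bullet> cadjoint (Z ** cadjoint Y)"
    by (simp only: inner_mult_left cadjoint_mult)
  finally show ?thesis by (simp only: inner_cadjoint)
qed

lemma inner_matrix_vector: "(A *v x) \<bullet> y = x \<bullet> (cadjoint A *v y)"
  for A :: "complex ^ 'n ^ 'm"
proof -
  have "(A *v x) \<bullet> y = Re (\<Sum>i\<in>UNIV. \<Sum>k\<in>UNIV. cnj (A $ i $ k) * cnj (x $ k) * y $ i)"
    by (simp add: inner_complex_vec matrix_vector_mult_def sum_distrib_right)
  also have "\<dots> = Re (\<Sum>k\<in>UNIV. \<Sum>i\<in>UNIV. cnj (A $ i $ k) * cnj (x $ k) * y $ i)"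
    by (rule arg_cong[where f = Re], rule sum.swap)
  also have "\<dots> = x \<bullet> (cadjoint A *v y)"
    by (simp add: inner_complex_vec matrix_vector_mult_def sum_distrib_left mult_ac)
  finally show ?thesis .
qed

lemma Re_trace_mult: "Re (trace (X ** Y)) = cadjoint X \<bullet> Y"
  by (subst inner_complex_matrix, subst sum.swap)
    (simp add: trace_def matrix_matrix_mult_def)

lemma Re_trace: "Re (trace (X ** cadjoint X)) = (norm X)\<^sup>2"
  by (simp add: Re_trace_mult inner_cadjoint power2_norm_eq_inner)

lemma unitary_cadjoint: "unitary U \<Longrightarrow> unitary (cadjoint U)"
  by (simp add: unitary_def)

lemma unitary_mult: "unitary U \<Longrightarrow> unitary V \<Longrightarrow> unitary (U ** V)"
  unfolding unitary_def cadjoint_mult by (metis matrix_mul_assoc matrix_mul_lid)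

lemma inner_unitary_left: "unitary U \<Longrightarrow> (U ** X) \<bullet> (U ** Y) = X \<bullet> Y"
  by (simp add: inner_mult_left matrix_mul_assoc unitary_def)

lemma inner_unitary_right: "unitary U \<Longrightarrow> (X ** U) \<bullet> (Y ** U) = X \<bullet> Y"
  by (simp add: inner_mult_right matrix_mul_assoc[symmetric] unitary_def)

lemma unitary_row_sum: 
  assumes "unitary U"
  shows "(\<Sum>j\<in>UNIV. (cmod (U $ i $ j))\<^sup>2) = 1"
proof -
  have "(U ** cadjoint U) $ i $ i = 1" using assms by (simp add: unitary_def mat_def)
  then have "complex_of_real (\<Sum>j\<in>UNIV. (cmod (U $ i $ j))\<^sup>2) = 1"
    by (simp add: matrix_matrix_mult_def complex_norm_square del: of_real_power)
  then show ?thesis by (simp only: of_real_eq_1_iff)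
qed

lemma unitary_column_sum: "unitary U \<Longrightarrow> (\<Sum>i\<in>UNIV. (cmod (U $ i $ j))\<^sup>2) = 1"
  using unitary_row_sum[OF unitary_cadjoint, of U j] by simp

section \<open>The spectral theorem\<close>

text \<open>A maximiser \<open>x\<close> of the Rayleigh quotient on the compact unit sphere of
  \<open>C\<close> is an eigenvector: otherwise a small move along the residue
  \<open>y = f x - c x\<close>, which stays in \<open>C\<close> by invariance, would raise the
  quotient to first order.\<close>

lemma selfadjoint_eigenvector:
  fixes f :: "'a::euclidean_space \<Rightarrow> 'a"
  assumes "linear f" and adj: "\<And>x y. f x \<bullet> y = x \<bullet> f y"
    and C: "subspace C" "f ` C \<subseteq> C" "\<not> C \<subseteq> {0}"
  obtains x c where "x \<in> C" "norm x = 1" "f x = c *\<^sub>R x"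
proof -
  interpret linear f by fact
  from C obtain z where z: "z \<in> C" "z \<noteq> 0" by auto
  have "z /\<^sub>R norm z \<in> C \<inter> sphere 0 1"
    using z C by (simp add: subspace_scale)
  then have "C \<inter> sphere 0 1 \<noteq> {}" by blast
  moreover have "compact (C \<inter> sphere 0 1)"
    using C by (intro closed_Int_compact closed_subspace) auto
  moreover have "continuous_on (C \<inter> sphere 0 1) (\<lambda>x. x \<bullet> f x)"
    using linear_continuous_on[OF linear_conv_bounded_linear[THEN iffD1, OF \<open>linear f\<close>]]
    by (intro continuous_intros) auto
  ultimately obtain x where x: "x \<in> C" "norm x = 1"
    and max: "\<And>y. y \<in> C \<Longrightarrow> norm y = 1 \<Longrightarrow> y \<bullet> f y \<le> x \<bullet> f x"
    using continuous_attains_sup[of "C \<inter> sphere 0 1" "\<lambda>x. x \<bullet> f x"]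
    by (metis Int_iff mem_sphere_0)
  define c where "c = x \<bullet> f x"
  have le: "y \<bullet> f y \<le> c * (y \<bullet> y)" if "y \<in> C" for y
  proof (cases "y = 0")
    case False
    have "(y /\<^sub>R norm y) \<bullet> f (y /\<^sub>R norm y) \<le> c"
      unfolding c_def using that False C by (intro max) (auto simp: subspace_scale)
    then have "(y \<bullet> f y) / (norm y * norm y) \<le> c"
      by (simp add: scale divide_inverse mult_ac)
    then show ?thesis
      using False by (simp add: divide_le_eq power2_norm_eq_inner[symmetric] power2_eq_square)
  qed (simp add: zero)
  define y where "y = f x - c *\<^sub>R x"
  have yC: "y \<in> C"
    using x C by (auto simp: y_def intro!: subspace_diff subspace_scale)
  define k where "k = c * (y \<bullet> y) - y \<bullet> f y"
  have yx: "y \<bullet> x = 0"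
    using x by (simp add: y_def c_def inner_diff_left inner_diff_right norm_eq_1 inner_commute)
  have yf: "y \<bullet> f x = y \<bullet> y"
    unfolding y_def using yx[unfolded y_def] by (simp add: inner_diff_right)
  have "2 * t * (y \<bullet> y) \<le> t\<^sup>2 * k" for t
  proof -
    have "(x + t *\<^sub>R y) \<bullet> f (x + t *\<^sub>R y) \<le> c * ((x + t *\<^sub>R y) \<bullet> (x + t *\<^sub>R y))"
      using x yC C by (intro le subspace_add subspace_scale) auto
    moreover have "(x + t *\<^sub>R y) \<bullet> f (x + t *\<^sub>R y) = c + 2 * t * (y \<bullet> y) + t\<^sup>2 * (y \<bullet> f y)"
      using yf adj[of x y]
      by (simp add: add scale inner_add_left inner_add_right c_def inner_commute power2_eq_square)
    moreover have "(x + t *\<^sub>R y) \<bullet> (x + t *\<^sub>R y) = 1 + t\<^sup>2 * (y \<bullet> y)"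
      using x yx
      by (simp add: inner_add_left inner_add_right norm_eq_1 inner_commute power2_eq_square)
    ultimately show ?thesis unfolding k_def by (simp only:) (simp add: algebra_simps)
  qed
  \<comment> \<open>For nonzero \<open>y\<close> this step size is so small that the linear term
    beats the quadratic one; \<open>\<bar>k\<bar> + 1\<close> keeps the denominator positive
    whatever the sign of \<open>k\<close>.\<close>
  from mult_right_mono[OF this[of "(y \<bullet> y) / (\<bar>k\<bar> + 1)"], of "(\<bar>k\<bar> + 1)\<^sup>2"]
  have "2 * (y \<bullet> y)\<^sup>2 * (\<bar>k\<bar> + 1) \<le> (y \<bullet> y)\<^sup>2 * k"
    by (simp add: power_divide power2_eq_square[of "y \<bullet> y"])
      (simp add: power2_eq_square mult.assoc split: if_splits)
  also have "\<dots> \<le> (y \<bullet> y)\<^sup>2 * (\<bar>k\<bar> + 1)"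
    by (intro mult_left_mono) auto
  finally have "(y \<bullet> y)\<^sup>2 * (\<bar>k\<bar> + 1) \<le> 0" by (simp add: algebra_simps)
  then have "y = 0"
    by (smt (verit) inner_eq_zero_iff mult_pos_pos zero_less_power2)
  then show ?thesis using that x by (auto simp: y_def)
qed

text \<open>Induction on the set of indices served: the orthogonal complement of the eigenvectors
  found so far is invariant under \<open>A\<close>, and it is nonzero while an index is missing, so
  it contains a further eigenvector.\<close>

lemma hermitian_orthonormal_eigenvectors:
  fixes A :: "complex ^ 'd ^ 'd" and S :: "'d set"
  assumes A: "cadjoint A = A"
  shows "\<exists>u l. (\<forall>i\<in>S. \<forall>j\<in>S. (\<Sum>k\<in>UNIV. cnj (u i $ k) * u j $ k) = (if i = j then 1 else 0)) \<and>
           (\<forall>i\<in>S. A *v u i = complex_of_real (l i) *s u i)"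
proof (induction S rule: finite_induct[OF finite])
  case (2 a S)
  then obtain u l where
    on: "\<And>i j. i \<in> S \<Longrightarrow> j \<in> S \<Longrightarrow> (\<Sum>k\<in>UNIV. cnj (u i $ k) * u j $ k) = (if i = j then 1 else 0)"
    and ev: "\<And>i. i \<in> S \<Longrightarrow> A *v u i = complex_of_real (l i) *s u i"
    by blast
  \<comment> \<open>Orthogonality is complex, but \<open>C\<close> is used as a real subspace; this
    is why the new eigenvalue comes out real.\<close>
  define C where "C = {x. \<forall>i\<in>S. (\<Sum>k\<in>UNIV. cnj (u i $ k) * x $ k) = 0}"
  \<comment> \<open>With the conjugated \<open>u i\<close> as rows and a zero row at
    \<open>a\<close>, \<open>N\<close> is singular; a kernel vector is a nonzero element of
    \<open>C\<close>.\<close>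
  define N :: "complex ^ 'd ^ 'd" where "N = (\<chi> i k. if i \<in> S then cnj (u i $ k) else 0)"
  have "det N = 0"
    using 2 by (intro det_zero_row(1)[of a]) (simp add: row_def N_def zero_vec_def)
  then have "\<not> (\<exists>B. B ** N = mat 1)"
    using invertible_det_nz invertible_left_inverse by blast
  then obtain x0 where x0: "N *v x0 = 0" "x0 \<noteq> 0"
    unfolding matrix_left_invertible_ker by blast
  have "(\<Sum>k\<in>UNIV. cnj (u i $ k) * x0 $ k) = 0" if "i \<in> S" for i
    using arg_cong[OF x0(1), of "\<lambda>v. v $ i"] that
    by (simp add: N_def matrix_vector_mult_def)
  then have "\<not> C \<subseteq> {0}" using x0 by (auto simp: C_def)
  moreover have "subspace C"
    by (auto simp: C_def subspace_def distrib_left sum.distrib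
        sum_distrib_left[symmetric] mult_scaleR_right scaleR_sum_right[symmetric])
  moreover have "A *v x \<in> C" if x: "x \<in> C" for x
  proof -
    have "(\<Sum>k\<in>UNIV. cnj (u i $ k) * (A *v x) $ k) = 0" if i: "i \<in> S" for i
    proof -
      have "(\<Sum>k\<in>UNIV. cnj (u i $ k) * (A *v x) $ k) =
          (\<Sum>k\<in>UNIV. \<Sum>m\<in>UNIV. cnj (u i $ k) * A $ k $ m * x $ m)"
        by (simp add: matrix_vector_mult_def sum_distrib_left mult_ac)
      also have "\<dots> = (\<Sum>m\<in>UNIV. \<Sum>k\<in>UNIV. cnj (u i $ k) * A $ k $ m * x $ m)"
        by (rule sum.swap)
      also have "\<dots> = (\<Sum>m\<in>UNIV. cnj ((A *v u i) $ m) * x $ m)"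
      proof -
        have "cnj (A $ m $ k) = A $ k $ m" for k m
          using arg_cong[OF A, of "\<lambda>B. B $ k $ m"] by simp
        then show ?thesis
          by (simp add: matrix_vector_mult_def sum_distrib_right sum_distrib_left mult_ac)
      qed
      also have "\<dots> = complex_of_real (l i) * (\<Sum>m\<in>UNIV. cnj (u i $ m) * x $ m)"
        by (simp add: ev[OF i] sum_distrib_left mult_ac)
      finally show ?thesis using x i by (simp add: C_def)
    qed
    then show ?thesis by (simp add: C_def)
  qed
  ultimately obtain x c where x: "x \<in> C" "norm x = 1" "A *v x = c *\<^sub>R x"
    using selfadjoint_eigenvector[of "(*v) A" C] inner_matrix_vector[of A] A
    by (metis (no_types, lifting) image_subsetI matrix_vector_mul_linear)
  have xx: "(\<Sum>k\<in>UNIV. cnj (x $ k) * x $ k) = 1"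
  proof -
    have "(\<Sum>k\<in>UNIV. cnj (x $ k) * x $ k) = complex_of_real (x \<bullet> x)"
      by (simp add: inner_vec_def dot_square_norm complex_norm_square mult.commute del: of_real_power)
    then show ?thesis using x by (simp add: norm_eq_1)
  qed
  have xu: "(\<Sum>k\<in>UNIV. cnj (x $ k) * u i $ k) = 0" if "i \<in> S" for i
  proof -
    have "(\<Sum>k\<in>UNIV. cnj (x $ k) * u i $ k) = cnj (\<Sum>k\<in>UNIV. cnj (u i $ k) * x $ k)"
      by (simp add: mult.commute)
    also have "\<dots> = 0" using x that by (simp add: C_def)
    finally show ?thesis .
  qed
  have "c *\<^sub>R x = complex_of_real c *s x"
    unfolding vec_eq_iff vector_scaleR_component by (simp add: scaleR_conv_of_real)
  then show ?case
    using x xx xu on ev \<open>a \<notin> S\<close>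
    by (intro exI[of _ "u(a := x)"] exI[of _ "l(a := c)"]) (auto simp: C_def)
qed auto

theorem hermitian_diagonalization:
  fixes A :: "complex ^ 'd ^ 'd"
  assumes "cadjoint A = A"
  obtains U l where "unitary U" "A = U ** real_diag l ** cadjoint U"
proof -
  obtain u :: "'d \<Rightarrow> complex ^ 'd" and l where
    on: "\<And>i j. (\<Sum>k\<in>UNIV. cnj (u i $ k) * u j $ k) = (if i = j then 1 else 0)"
    and ev: "\<And>i. A *v u i = complex_of_real (l i) *s u i"
    using hermitian_orthonormal_eigenvectors[OF assms, of UNIV] by auto
  define U :: "complex ^ 'd ^ 'd" where "U = (\<chi> k i. u i $ k)"
  have "cadjoint U ** U = mat 1"
    using on by (simp add: vec_eq_iff U_def matrix_matrix_mult_def mat_def)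
  then have U: "unitary U"
    by (simp add: unitary_def matrix_left_right_inverse)
  have "(A ** U) $ k $ i = (U ** real_diag l) $ k $ i" for k i
    using arg_cong[OF ev[of i], of "\<lambda>v. v $ k"]
    by (simp add: real_diag_mult_nth) (simp add: U_def matrix_matrix_mult_def matrix_vector_mult_def mult.commute)
  then have "A ** U = U ** real_diag l" by (simp add: vec_eq_iff)
  then have "A = U ** real_diag l ** cadjoint U"
    using U unfolding unitary_def by (metis matrix_mul_assoc matrix_mul_rid)
  then show ?thesis using U that by blast
qed

section \<open>Positive semidefinite matrices\<close>

lemma positive_semidef_iff: "positive_semidef A \<longleftrightarrow> cadjoint A = A \<and> (\<forall>v. 0 \<le> v \<bullet> (A *v v))"
  by (simp add: positive_semidef_def inner_complex_vec)

lemma positive_semidef_congruence: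
  assumes "positive_semidef A"
  shows "positive_semidef (cadjoint X ** A ** X)"
proof -
  have "v \<bullet> ((cadjoint X ** A ** X) *v v) = (X *v v) \<bullet> (A *v (X *v v))" for v
    by (simp add: inner_matrix_vector matrix_vector_mul_assoc matrix_mul_assoc)
  then show ?thesis
    using assms by (simp add: positive_semidef_iff cadjoint_mult matrix_mul_assoc)
qed

lemma real_diag_mult_vector_nth: "(real_diag l *v v) $ i = complex_of_real (l i) * v $ i"
  by (simp add: matrix_vector_mult_def real_diag_def if_distrib[of "\<lambda>z. z * _"] cong: if_cong)

lemma positive_semidef_real_diag_iff: "positive_semidef (real_diag l) \<longleftrightarrow> (\<forall>i. 0 \<le> l i)"
proof
  assume *: "\<forall>i. 0 \<le> l i"
  have "v \<bullet> (real_diag l *v v) = (\<Sum>i\<in>UNIV. l i * (v $ i \<bullet> v $ i))" for v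
    by (simp add: inner_vec_def real_diag_mult_vector_nth inner_complex_def algebra_simps)
  then show "positive_semidef (real_diag l)"
    using * by (simp add: positive_semidef_iff sum_nonneg)
next
  assume *: "positive_semidef (real_diag l)"
  show "\<forall>i. 0 \<le> l i"
  proof
    fix i
    have "0 \<le> axis i 1 \<bullet> (real_diag l *v axis i 1)"
      using * unfolding positive_semidef_iff by blast
    also have "\<dots> = l i"
      by (simp add: inner_axis' real_diag_mult_vector_nth)
    finally show "0 \<le> l i" .
  qed
qed

lemma positive_semidef_diagonalization:
  assumes "positive_semidef A"
  obtains U l where "unitary U" "A = U ** real_diag l ** cadjoint U" "\<And>i. 0 \<le> l i"
proof -
  obtain U l where U: "unitary U" and A: "A = U ** real_diag l ** cadjoint U"
    using hermitian_diagonalization assms unfolding positive_semidef_iff by blast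
  have "cadjoint U ** A ** U = real_diag l"
    using U unfolding A unitary_def by (metis matrix_mul_assoc matrix_mul_lid matrix_mul_rid)
  then show ?thesis
    using positive_semidef_congruence[OF assms, of U] that[OF U A]
    by (simp add: positive_semidef_real_diag_iff)
qed

lemma positive_semidef_square: "positive_semidef (X ** cadjoint X)"
proof -
  have "positive_semidef (real_diag (\<lambda>_. 1))"
    by (simp only: positive_semidef_real_diag_iff) simp
  from positive_semidef_congruence[OF this, of "cadjoint X"] show ?thesis by simp
qed

lemma positive_semidef_sqrt:
  assumes "positive_semidef A"
  obtains S where "positive_semidef S" "S ** S = A"
proof -
  from assms obtain U l where U: "unitary U" and A: "A = U ** real_diag l ** cadjoint U"
    and l: "\<And>i. 0 \<le> l i"
    using positive_semidef_diagonalization by blast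
  define S where "S = U ** real_diag (sqrt \<circ> l) ** cadjoint U"
  have "positive_semidef S"
    unfolding S_def using positive_semidef_congruence[of "real_diag (sqrt \<circ> l)" "cadjoint U"] l
    by (simp add: positive_semidef_real_diag_iff)
  moreover have "S ** S = U ** (real_diag (sqrt \<circ> l) ** real_diag (sqrt \<circ> l)) ** cadjoint U"
    using U unfolding S_def unitary_def by (metis matrix_mul_assoc matrix_mul_lid matrix_mul_rid)
  then have "S ** S = A" by (simp add: A real_diag_mult l)
  ultimately show ?thesis using that by blast
qed

lemma positive_semidef_factor:
  fixes A :: "complex ^ 'd ^ 'd"
  assumes "positive_semidef A"
  obtains X :: "complex ^ 'd ^ 'd" where "A = X ** cadjoint X"
proof -
  obtain S where "positive_semidef S" "S ** S = A"
    using positive_semidef_sqrt[OF assms] .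
  then show ?thesis using that[of S] by (simp add: positive_semidef_iff)
qed

section \<open>Inequalities for entropy and logarithms\<close>

lemma one_minus_times_ln_ge:
  fixes x :: real
  assumes "0 < x" "x \<le> 1/2"
  shows "x * ln x \<le> (1 - x) * ln (1 - x)"
proof -
  \<comment> \<open>For this \<open>t\<close>, \<open>1 - x\<close> is the convex combination of
    \<open>x\<close> and \<open>1\<close> with weights \<open>1 - t = x / (1 - x)\<close> and
    \<open>t\<close>. As \<open>ln 1 = 0\<close>, concavity of \<open>ln\<close> is the claim up to
    the factor \<open>1 - x\<close>.\<close>
  define t where "t = (1 - 2 * x) / (1 - x)"
  have t: "0 \<le> t" "t \<le> 1" using assms by (auto simp: t_def field_simps)
  have "(1 - t) * ln x + t * ln 1 \<le> ln ((1 - t) *\<^sub>R x + t *\<^sub>R 1)"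
    using concave_onD[OF ln_concave, of t x 1] assms t by auto
  also have "(1 - t) *\<^sub>R x + t *\<^sub>R 1 = 1 - x"
  proof -
    have "1 - t = x / (1 - x)" using assms by (simp add: t_def diff_divide_eq_iff)
    then have "(1 - t) * x + t = (x * x + (1 - 2 * x)) / (1 - x)"
      by (simp add: t_def add_divide_distrib)
    also have "x * x + (1 - 2 * x) = (1 - x) * (1 - x)"
      by (simp add: algebra_simps)
    finally show ?thesis using assms by simp
  qed
  finally have "(x / (1 - x)) * ln x \<le> ln (1 - x)"
    using assms by (simp add: t_def field_simps)
  then show ?thesis using assms by (simp add: field_simps)
qed

text \<open>The quotient of entropy and \<open>sqrt (x * (1 - x))\<close> is nondecreasing up to
  \<open>1/2\<close>, where it equals \<open>2 * ln 2\<close>. Up to positive factors its derivative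
  is \<open>(1 - y) * ln (1 - y) - y * ln y\<close>.\<close>

lemma entropy_le_sqrt_aux:
  fixes x :: real
  assumes "0 < x" "x \<le> 1/2"
  shows "- x * ln x - (1 - x) * ln (1 - x) \<le> 2 * ln 2 * sqrt (x * (1 - x))"
proof -
  let ?h = "\<lambda>x::real. - x * ln x - (1 - x) * ln (1 - x)"
  have "?h x / sqrt (x * (1 - x)) \<le> ?h (1/2) / sqrt ((1/2) * (1 - 1/2))"
  proof (rule DERIV_nonneg_imp_nondecreasing[OF assms(2)])
    fix y :: real assume y: "x \<le> y" "y \<le> 1/2"
    let ?s = "sqrt (y * (1 - y))"
    have pos: "0 < y" "0 < 1 - y" "0 < y * (1 - y)" "0 < ?s" using y assms by auto
    have "((\<lambda>y. ?h y / sqrt (y * (1 - y))) has_real_derivative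
       (((ln (1 - y) - ln y) * ?s - ?h y * ((1 - 2 * y) * (inverse ?s / 2))) / (?s * ?s))) (at y)"
    proof -
      have h: "(?h has_real_derivative (ln (1 - y) - ln y)) (at y)"
        using pos by (auto intro!: derivative_eq_intros)
      have "((\<lambda>y. sqrt (y * (1 - y))) has_real_derivative ((1 - 2 * y) * (inverse ?s / 2))) (at y)"
        using pos by (auto intro!: derivative_eq_intros simp: mult_less_0_iff)
      from DERIV_divide[OF h this] show ?thesis
        using pos(4) by (metis less_irrefl)
    qed
    moreover have "0 \<le> (((ln (1 - y) - ln y) * ?s - ?h y * ((1 - 2 * y) * (inverse ?s / 2))) / (?s * ?s))"
    proof -
      have "((ln (1 - y) - ln y) * ?s - ?h y * ((1 - 2 * y) * (inverse ?s / 2))) * ?s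
        = (ln (1 - y) - ln y) * (?s * ?s) - ?h y * (1 - 2 * y) / 2"
        using pos by (simp add: field_simps)
      also have "\<dots> = (ln (1 - y) - ln y) * (y * (1 - y)) - ?h y * (1 - 2 * y) / 2"
        using pos by simp
      also have "\<dots> = ((1 - y) * ln (1 - y) - y * ln y) / 2"
        by (simp add: field_simps)
      also have "\<dots> \<ge> 0"
        using one_minus_times_ln_ge[of y] pos y by simp
      finally show ?thesis
        using pos by (simp add: zero_le_mult_iff)
    qed
    ultimately show "\<exists>z. ((\<lambda>y. ?h y / sqrt (y * (1 - y))) has_real_derivative z) (at y) \<and> 0 \<le> z"
      by blast
  qed
  also have "\<dots> = 2 * ln 2"
    by (simp add: real_sqrt_divide ln_div)
  finally show ?thesis
    using assms by (simp add: field_simps)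
qed

lemma binary_entropy_le_sqrt:
  assumes "0 \<le> x" "x \<le> 1"
  shows "binary_entropy x \<le> 2 * sqrt (x * (1 - x))"
proof -
  have *: "binary_entropy y \<le> 2 * sqrt (y * (1 - y))" if "0 \<le> y" "y \<le> 1/2" for y
  proof (cases "y = 0")
    case False
    then have "(- y * ln y - (1 - y) * ln (1 - y)) / ln 2 \<le> 2 * sqrt (y * (1 - y))"
      using entropy_le_sqrt_aux[of y] that by (simp add: field_simps)
    then show ?thesis
      by (simp add: binary_entropy_def log_def diff_divide_distrib)
  qed (simp add: binary_entropy_def)
  show ?thesis
  proof (cases "x \<le> 1/2")
    case False
    then show ?thesis
      using *[of "1 - x"] assms
      by (simp add: binary_entropy_def mult.commute[of "1 - x" x]) (simp add: algebra_simps)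
  qed (use * assms in auto)
qed

text \<open>The entropy bound at \<open>x = a / (a + b)\<close>, multiplied by \<open>a + b\<close>.
  When \<open>a\<close> and \<open>b\<close> are the joint probabilities of one outcome with the two
  values of \<open>X\<close>, \<open>x\<close> is a posterior of \<open>X\<close>.\<close>

lemma entropy_pair_ge:
  fixes a b :: real
  assumes "0 \<le> a" "0 \<le> b"
  shows "a * log 2 (a / (a + b)) + b * log 2 (b / (a + b)) \<ge> - 2 * sqrt (a * b)"
proof (cases "a + b = 0")
  case False
  then have pos: "0 < a + b" using assms by simp
  define x where "x = a / (a + b)"
  have x: "0 \<le> x" "x \<le> 1" "1 - x = b / (a + b)" using assms pos by (auto simp: x_def field_simps)
  have "sqrt (x * (1 - x)) = sqrt (a * b) / (a + b)"
    using pos by (simp add: x x_def[symmetric]) (simp add: x_def real_sqrt_divide)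
  with binary_entropy_le_sqrt[OF x(1,2)]
  have "- (a / (a + b)) * log 2 (a / (a + b)) - (b / (a + b)) * log 2 (b / (a + b))
        \<le> 2 * (sqrt (a * b) / (a + b))"
    by (simp add: binary_entropy_def x(3)) (simp add: x_def)
  then have "(- (a / (a + b)) * log 2 (a / (a + b)) - (b / (a + b)) * log 2 (b / (a + b))) * (a + b)
        \<le> 2 * (sqrt (a * b) / (a + b)) * (a + b)"
    using pos by (intro mult_right_mono) auto
  then show ?thesis using pos by (simp add: left_diff_distrib)
next
  case True
  then have "a = 0" "b = 0" using assms by auto
  then show ?thesis by simp
qed

text \<open>
  Both sides are values at \<open>u = 0\<close> of \<open>\<Sum>k. m k * ln (t k + u)\<close>, whose \<open>u\<close>-derivatives the
  hypothesis compares; as the total weights agree, the difference vanishes for \<open>u \<rightarrow> \<infinity>\<close>.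
\<close>

lemma sum_ln_mono_if_resolvent_mono:
  fixes m t :: "'a \<Rightarrow> real" and n s :: "'b \<Rightarrow> real"
  assumes fin: "finite I" "finite J"
    and t: "\<And>k. k \<in> I \<Longrightarrow> m k \<noteq> 0 \<Longrightarrow> 0 < t k"
    and s: "\<And>k. k \<in> J \<Longrightarrow> n k \<noteq> 0 \<Longrightarrow> 0 < s k"
    and total: "(\<Sum>k\<in>I. m k) = (\<Sum>k\<in>J. n k)"
    and resolvent: "\<And>u. 0 < u \<Longrightarrow> (\<Sum>k\<in>I. m k / (t k + u)) \<le> (\<Sum>k\<in>J. n k / (s k + u))"
  shows "(\<Sum>k\<in>J. n k * ln (s k)) \<le> (\<Sum>k\<in>I. m k * ln (t k))"
proof -
  define D where "D u = (\<Sum>k\<in>I. m k * ln (t k + u)) - (\<Sum>k\<in>J. n k * ln (s k + u))" for u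
  have deriv_term: "((\<lambda>u. w * ln (x + u)) has_real_derivative (w / (x + u))) (at u)"
    if "w \<noteq> 0 \<Longrightarrow> 0 < x" "0 < u" for w x u :: real
    using that by (cases "w = 0") (auto intro!: derivative_eq_intros)
  have deriv: "(D has_real_derivative
      ((\<Sum>k\<in>I. m k / (t k + u)) - (\<Sum>k\<in>J. n k / (s k + u)))) (at u)" if "0 < u" for u
    unfolding D_def using t s that
    by (intro DERIV_diff DERIV_sum deriv_term) auto
  have antimono: "D v \<le> D u" if "0 < u" "u \<le> v" for u v
    by (rule DERIV_nonpos_imp_nonincreasing[OF that(2)])
      (use deriv resolvent that in \<open>metis diff_le_0_iff_le less_le_trans\<close>)
  have "(D \<longlongrightarrow> 0) at_top"
  proof -
    \<comment> \<open>Every logarithm is compared with \<open>ln u\<close>; the subtracted multiples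
      of \<open>ln u\<close> cancel since the total weights agree.\<close>
    have *: "((\<lambda>u. w * (ln (x + u) - ln u)) \<longlongrightarrow> 0) at_top" for w x :: real
      by real_asymp
    have "((\<lambda>u. (\<Sum>k\<in>I. m k * (ln (t k + u) - ln u)) - (\<Sum>k\<in>J. n k * (ln (s k + u) - ln u)))
        \<longlongrightarrow> (\<Sum>k\<in>I. 0) - (\<Sum>k\<in>J. 0)) at_top"
      by (intro tendsto_intros *)
    then show ?thesis
      using total unfolding D_def[abs_def]
      by (simp add: right_diff_distrib sum_subtractf sum_distrib_right[symmetric])
  qed
  then have nonneg: "0 \<le> D u" if "0 < u" for u
    by (rule tendsto_upperbound)
      (use antimono that in \<open>auto simp: eventually_at_top_linorder\<close>)
  \<comment> \<open>Terms whose \<open>t k\<close> or \<open>s k\<close> is not positive have weight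
    0, so \<open>D\<close> is right-continuous at 0.\<close>
  have "(D \<longlongrightarrow> D 0) (at_right 0)"
  proof -
    have *: "((\<lambda>u. w * ln (x + u)) \<longlongrightarrow> w * ln (x + 0)) (at_right 0)"
      if "w \<noteq> 0 \<Longrightarrow> 0 < x" for w x :: real
      using that by (cases "w = 0") (auto intro!: tendsto_eq_intros)
    show ?thesis unfolding D_def
      using t s by (intro tendsto_intros *) auto
  qed
  then have "0 \<le> D 0"
    by (rule tendsto_lowerbound)
      (use nonneg in \<open>auto simp: eventually_at_right_less intro: eventually_mono[OF eventually_at_right_less]\<close>)
  then show ?thesis by (simp add: D_def)
qed

section \<open>Classical information of a measurement\<close>

text \<open>Serves to split the prior \<open>s\<close> off a posterior \<open>s * x / y\<close>. The
  hypothesis \<open>s * x \<le> y\<close> makes \<open>y\<close> positive whenever the terms do not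
  all vanish.\<close>

lemma mult_log_divide_scale:
  fixes s x y :: real
  assumes "0 \<le> s" "0 \<le> x" "s * x \<le> y"
  shows "s * x * log 2 (x / y) = s * x * log 2 (s * x / y) - s * x * log 2 s"
proof (cases "s * x = 0")
  case False
  then have "0 < s * x" using assms by (simp add: less_le)
  then have "0 < y" using assms by linarith
  moreover have "0 < s" "0 < x" using assms False by (auto simp: less_le)
  ultimately show ?thesis by (simp add: log_divide log_mult right_diff_distrib distrib_left)
qed auto

text \<open>With \<open>z = sqrt (y / (x * K))\<close> one has
  \<open>ln (x / y) = - ln K - 2 * ln z\<close>, and \<open>ln z \<le> z - 1\<close>.\<close>

lemma mult_ln_divide_ge:
  fixes s x y K :: real
  assumes "0 \<le> s" "0 \<le> x" "s * x \<le> y" "0 < K"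
  shows "s * x * ln (x / y) \<ge> - (s * x * ln K) + 2 * (s * x) - 2 * sqrt y * (s * sqrt x) / sqrt K"
proof (cases "s * x = 0")
  case False
  then have "0 < s * x" using assms by (simp add: less_le)
  then have "0 < y" using assms by linarith
  moreover have "0 < s" "0 < x" using assms False by (auto simp: less_le)
  ultimately have pos: "0 < s" "0 < x" "0 < y" by auto
  define z where "z = sqrt (y / (x * K))"
  have z: "0 < z" using pos assms by (simp add: z_def)
  have "ln (x / y) = - ln K - 2 * ln z"
    using pos assms by (simp add: z_def ln_sqrt ln_div ln_mult diff_divide_distrib add_divide_distrib)
  moreover have "ln z \<le> z - 1" using z by (rule ln_le_minus_one)
  ultimately have "ln (x / y) \<ge> - ln K + 2 - 2 * z" by simp
  then have "s * x * ln (x / y) \<ge> s * x * (- ln K + 2 - 2 * z)"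
    using pos by (intro mult_left_mono) auto
  moreover have "x * z = sqrt y * sqrt x / sqrt K"
  proof -
    have "x * z = sqrt x * sqrt x * (sqrt y / (sqrt x * sqrt K))"
      using pos by (simp add: z_def real_sqrt_divide real_sqrt_mult)
    moreover have "a * a * (c / (a * d)) = c * a / d" if "a \<noteq> 0" for a c d :: real
      using that by simp
    ultimately show ?thesis using pos by (metis real_sqrt_eq_zero_cancel_iff less_irrefl)
  qed
  then have "2 * sqrt y * (s * sqrt x) / sqrt K = 2 * (s * x * z)" by (simp add: mult_ac)
  ultimately show ?thesis by (simp only:) (simp add: algebra_simps)
qed (use assms in auto)

context
  fixes p :: real and q0 q1 :: "nat \<Rightarrow> real" and n :: nat
  assumes p: "0 \<le> p" "p \<le> 1"
    and q: "\<And>m. 0 \<le> q0 m" "\<And>m. 0 \<le> q1 m"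
    and sums: "(\<Sum>m<n. q0 m) = 1" "(\<Sum>m<n. q1 m) = 1"
begin

abbreviation "mixture m \<equiv> p * q0 m + (1 - p) * q1 m"

text \<open>The mutual information \<open>I(X:Y)\<close> as the average relative entropy of
  \<open>q0\<close> and \<open>q1\<close> to their mixture.\<close>

abbreviation "information \<equiv>
  (\<Sum>m<n. p * q0 m * log 2 (q0 m / mixture m) + (1 - p) * q1 m * log 2 (q1 m / mixture m))"

text \<open>This is \<open>I(X:Y) = H(X) - H(X|Y)\<close>: splitting off the priors turns likelihood
  ratios into posteriors.\<close>

lemma information_eq:
  "information = binary_entropy p + (\<Sum>m<n. p * q0 m * log 2 (p * q0 m / mixture m) +
     (1 - p) * q1 m * log 2 ((1 - p) * q1 m / mixture m))"
proof -
  have "information = (\<Sum>m<n. (p * q0 m * log 2 (p * q0 m / mixture m) +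
     (1 - p) * q1 m * log 2 ((1 - p) * q1 m / mixture m)) - q0 m * (p * log 2 p) - q1 m * ((1 - p) * log 2 (1 - p)))"
  proof (intro sum.cong refl)
    fix m
    have "0 \<le> p * q0 m" "0 \<le> (1 - p) * q1 m" using p q by auto
    then have "p * q0 m \<le> mixture m" "(1 - p) * q1 m \<le> mixture m" by linarith+
    then have "p * q0 m * log 2 (q0 m / mixture m) =
          p * q0 m * log 2 (p * q0 m / mixture m) - p * q0 m * log 2 p"
      "(1 - p) * q1 m * log 2 (q1 m / mixture m) =
          (1 - p) * q1 m * log 2 ((1 - p) * q1 m / mixture m) - (1 - p) * q1 m * log 2 (1 - p)"
      using p q by (auto intro!: mult_log_divide_scale)
    then show "p * q0 m * log 2 (q0 m / mixture m) + (1 - p) * q1 m * log 2 (q1 m / mixture m) =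
        p * q0 m * log 2 (p * q0 m / mixture m) + (1 - p) * q1 m * log 2 ((1 - p) * q1 m / mixture m)
          - q0 m * (p * log 2 p) - q1 m * ((1 - p) * log 2 (1 - p))"
      by (simp only:) (simp add: mult_ac)
  qed
  also have "\<dots> = (\<Sum>m<n. (p * q0 m * log 2 (p * q0 m / mixture m) +
     (1 - p) * q1 m * log 2 ((1 - p) * q1 m / mixture m))) - (\<Sum>m<n. q0 m) * (p * log 2 p) - (\<Sum>m<n. q1 m) * ((1 - p) * log 2 (1 - p))"
    by (simp only: sum_subtractf sum_distrib_right)
  finally show ?thesis by (simp add: sums binary_entropy_def)
qed

lemma information_le: "information \<le> binary_entropy p"
proof -
  have *: "a * log 2 (a / (a + b)) \<le> 0" "b * log 2 (b / (a + b)) \<le> 0" if "0 \<le> a" "0 \<le> b" for a b :: real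
    using that by (cases "a = 0"; cases "b = 0"; simp add: mult_le_0_iff)+
  show ?thesis unfolding information_eq
    using p q by (simp add: sum_nonpos add_nonpos_nonpos *)
qed

text \<open>Bounds \<open>H(X|Y)\<close> outcome by outcome, with the two joint probabilities as the
  pair.\<close>

lemma information_ge_binary_entropy:
  "information \<ge> binary_entropy p - 2 * sqrt (p * (1 - p)) * (\<Sum>m<n. sqrt (q0 m * q1 m))"
proof -
  have "- (2 * sqrt (p * (1 - p)) * (\<Sum>m<n. sqrt (q0 m * q1 m))) =
      (\<Sum>m<n. - 2 * sqrt (p * q0 m * ((1 - p) * q1 m)))"
    by (simp add: sum_distrib_left sum_negf real_sqrt_mult mult_ac)
  also have "\<dots> \<le> (\<Sum>m<n. p * q0 m * log 2 (p * q0 m / mixture m) +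
     (1 - p) * q1 m * log 2 ((1 - p) * q1 m / mixture m))"
    using p q by (intro sum_mono entropy_pair_ge) auto
  finally show ?thesis unfolding information_eq by simp
qed

text \<open>Jensen's inequality for \<open>ln\<close>, applied in its tangent form at \<open>K\<close>.\<close>

lemma information_ge_log:
  "information \<ge> - log 2 (p\<^sup>2 + (1 - p)\<^sup>2 + 2 * p * (1 - p) * (\<Sum>m<n. sqrt (q0 m * q1 m)))"
proof -
  define K where "K = p\<^sup>2 + (1 - p)\<^sup>2 + 2 * p * (1 - p) * (\<Sum>m<n. sqrt (q0 m * q1 m))"
  \<comment> \<open>The squares of \<open>A m\<close> sum to \<open>K\<close>, so
    \<open>(A m)\<^sup>2 / K\<close> is a probability distribution, as is \<open>mixture\<close>;
    their contributions to the next sum cancel.\<close>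
  define A where "A m = p * sqrt (q0 m) + (1 - p) * sqrt (q1 m)" for m
  have "0 < p\<^sup>2 + (1 - p)\<^sup>2" by (auto simp: sum_power2_gt_zero_iff)
  moreover have "0 \<le> 2 * p * (1 - p) * (\<Sum>m<n. sqrt (q0 m * q1 m))"
    using p q by (intro mult_nonneg_nonneg sum_nonneg) auto
  ultimately have K: "0 < K" unfolding K_def by (rule add_pos_nonneg)
  have "(A m)\<^sup>2 = p\<^sup>2 * q0 m + (1 - p)\<^sup>2 * q1 m + 2 * p * (1 - p) * sqrt (q0 m * q1 m)" for m
    using q by (simp add: A_def power2_sum power_mult_distrib real_sqrt_mult)
  then have "(\<Sum>m<n. (A m)\<^sup>2) = K"
    by (simp add: K_def sum.distrib sum_distrib_left[symmetric] sums)
  then have "- ln K = (\<Sum>m<n. - (mixture m * ln K) + mixture m - (A m)\<^sup>2 / K)"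
    using K by (simp add: sum.distrib sum_subtractf sum_negf sum_distrib_left[symmetric]
      sum_distrib_right[symmetric] sum_divide_distrib[symmetric] sums)
  also have "\<dots> \<le> (\<Sum>m<n. p * q0 m * ln (q0 m / mixture m) + (1 - p) * q1 m * ln (q1 m / mixture m))"
  proof (rule sum_mono)
    fix m
    \<comment> \<open>This square absorbs the cross terms that the two tangent estimates
      produce.\<close>
    have "0 \<le> (sqrt (mixture m) - A m / sqrt K)\<^sup>2" by simp
    also have "\<dots> = mixture m + (A m)\<^sup>2 / K - 2 * sqrt (mixture m) * A m / sqrt K"
      using p q K by (simp add: power2_diff power_divide)
    finally have "2 * sqrt (mixture m) * A m / sqrt K \<le> mixture m + (A m)\<^sup>2 / K" by simp
    moreover have "2 * sqrt (mixture m) * A m / sqrt K =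
        2 * sqrt (mixture m) * (p * sqrt (q0 m)) / sqrt K +
        2 * sqrt (mixture m) * ((1 - p) * sqrt (q1 m)) / sqrt K"
      by (simp add: A_def distrib_left add_divide_distrib)
    moreover have "mixture m * ln K = p * q0 m * ln K + (1 - p) * q1 m * ln K"
      by (rule distrib_right)
    moreover have "p * q0 m * ln (q0 m / mixture m) \<ge>
        - (p * q0 m * ln K) + 2 * (p * q0 m) - 2 * sqrt (mixture m) * (p * sqrt (q0 m)) / sqrt K"
      using p q K by (intro mult_ln_divide_ge) auto
    moreover have "(1 - p) * q1 m * ln (q1 m / mixture m) \<ge>
        - ((1 - p) * q1 m * ln K) + 2 * ((1 - p) * q1 m) - 2 * sqrt (mixture m) * ((1 - p) * sqrt (q1 m)) / sqrt K"
      using p q K by (intro mult_ln_divide_ge) auto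
    ultimately show "- (mixture m * ln K) + mixture m - (A m)\<^sup>2 / K \<le>
        p * q0 m * ln (q0 m / mixture m) + (1 - p) * q1 m * ln (q1 m / mixture m)"
      by linarith
  qed
  finally have "- ln K / ln 2 \<le> (\<Sum>m<n. p * q0 m * ln (q0 m / mixture m) + (1 - p) * q1 m * ln (q1 m / mixture m)) / ln 2"
    by (intro divide_right_mono) auto
  then show ?thesis
    by (simp add: K_def[symmetric] log_def sum_divide_distrib add_divide_distrib)
qed

end

section \<open>Outcome distributions and accessible information\<close>

text \<open>For \<open>E = X X\<^sup>*\<close> and \<open>\<rho> = A A\<^sup>*\<close> the trace is
  the squared norm of \<open>A\<^sup>* X\<close>.\<close>

lemma trace_mult_positive_semidef_nonneg:
  fixes E \<rho> :: "complex ^ 'd ^ 'd"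
  assumes "positive_semidef E" "positive_semidef \<rho>"
  shows "0 \<le> Re (trace (E ** \<rho>))"
proof -
  obtain X :: "complex ^ 'd ^ 'd" where E: "E = X ** cadjoint X" using positive_semidef_factor[OF assms(1)] .
  obtain A :: "complex ^ 'd ^ 'd" where \<rho>: "\<rho> = A ** cadjoint A" using positive_semidef_factor[OF assms(2)] .
  have "Re (trace (E ** \<rho>)) = (cadjoint A ** X) \<bullet> (cadjoint A ** X)"
    by (simp add: E \<rho> Re_trace_mult cadjoint_mult inner_mult_right inner_mult_left matrix_mul_assoc inner_commute)
  then show ?thesis by simp
qed

context
  fixes n and E :: "nat \<Rightarrow> complex ^ 'd ^ 'd"
  assumes povm: "povm n E"
begin

lemma sum_outcomes:
  assumes "density_operator \<rho>"
  shows "(\<Sum>m<n. Re (trace (E m ** \<rho>))) = 1"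
proof -
  have "(\<Sum>m<n. Re (trace (E m ** \<rho>))) = cadjoint \<rho> \<bullet> (\<Sum>m<n. E m)"
    by (simp add: trace_mul_sym[of _ \<rho>] Re_trace_mult inner_sum_right)
  also have "\<dots> = Re (trace (\<rho> ** mat 1))"
    using povm unfolding povm_def Re_trace_mult by simp
  finally show ?thesis using assms by (simp add: density_operator_def)
qed

lemma outcome_nonneg:
  assumes "density_operator \<rho>" "m < n"
  shows "0 \<le> Re (trace (E m ** \<rho>))"
  using trace_mult_positive_semidef_nonneg assms povm
  unfolding density_operator_def povm_def by blast

lemma pmf_outcome:
  assumes "density_operator \<rho>"
  shows "pmf (outcome_pmf n E \<rho>) m = (if m < n then Re (trace (E m ** \<rho>)) else 0)"
  unfolding outcome_pmf_def
proof (rule pmf_embed_pmf)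
  let ?q = "\<lambda>m. if m < n then Re (trace (E m ** \<rho>)) else 0"
  show "\<And>m. 0 \<le> ?q m" using outcome_nonneg assms by simp
  have "(\<integral>\<^sup>+ m. ennreal (?q m) \<partial>count_space UNIV) = (\<Sum>m<n. ennreal (?q m))"
    by (rule nn_integral_count_space') (auto simp: outcome_nonneg assms)
  also have "\<dots> = ennreal (\<Sum>m<n. Re (trace (E m ** \<rho>)))"
    using outcome_nonneg assms by (subst sum_ennreal) auto
  finally show "(\<integral>\<^sup>+ m. ennreal (?q m) \<partial>count_space UNIV) = 1"
    by (simp add: sum_outcomes assms)
qed

lemma information_measurement:
  fixes \<rho>0 \<rho>1 :: "complex ^ 'd ^ 'd"
  assumes p: "0 \<le> p" "p \<le> 1" and \<rho>: "density_operator \<rho>0" "density_operator \<rho>1"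
  defines "q0 \<equiv> pmf (outcome_pmf n E \<rho>0)" and "q1 \<equiv> pmf (outcome_pmf n E \<rho>1)"
  shows "pmf_mutual_information (measurement_pmf p \<rho>0 \<rho>1 n E) =
    (\<Sum>m<n. p * q0 m * log 2 (q0 m / (p * q0 m + (1 - p) * q1 m)) +
      (1 - p) * q1 m * log 2 (q1 m / (p * q0 m + (1 - p) * q1 m)))"
proof -
  let ?J = "measurement_pmf p \<rho>0 \<rho>1 n E"
  let ?P = "\<lambda>x. if x then 1 - p else p" and ?q = "\<lambda>x. if x then q1 else q0"
  have Pair: "pmf (map_pmf (Pair x) M) (y, m) = (if x = y then pmf M m else 0)"
    for x y :: bool and m and M :: "nat pmf"
    using pmf_map_inj'[of "Pair x" M m]
    by (auto simp: inj_on_def intro!: pmf_map_outside)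
  have J: "pmf ?J (x, m) = ?P x * ?q x m" for x m
    using p by (auto simp: measurement_pmf_def pmf_bind Pair q0_def q1_def)
  have fst: "map_pmf fst ?J = bernoulli_pmf (1 - p)"
    by (simp add: measurement_pmf_def map_bind_pmf map_pmf_comp bind_return_pmf')
  have snd: "pmf (map_pmf snd ?J) m = p * q0 m + (1 - p) * q1 m" for m
    using p by (simp add: measurement_pmf_def map_bind_pmf map_pmf_comp pmf_bind q0_def q1_def)
  have q0: "q0 m = 0" "q1 m = 0" if "\<not> m < n" for m
    using that by (auto simp: q0_def q1_def pmf_outcome \<rho>)
  have sub: "set_pmf ?J \<subseteq> UNIV \<times> {..<n}"
    using q0 by (auto simp: set_pmf_iff J split: if_splits) (metis linorder_not_less)+
  then have "finite (set_pmf ?J)" by (rule finite_subset) simp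
  then have "pmf_mutual_information ?J = (\<Sum>(x, m)\<in>set_pmf ?J. pmf ?J (x, m) *
       log 2 (pmf ?J (x, m) / (pmf (map_pmf fst ?J) x * pmf (map_pmf snd ?J) m)))"
    by (rule pmf_mutual_information_eq_sum)
  also have "\<dots> = (\<Sum>(x, m)\<in>UNIV \<times> {..<n}. pmf ?J (x, m) *
       log 2 (pmf ?J (x, m) / (pmf (map_pmf fst ?J) x * pmf (map_pmf snd ?J) m)))"
    using sub by (intro sum.mono_neutral_left) (auto simp: set_pmf_iff)
  also have "\<dots> = (\<Sum>x\<in>UNIV. \<Sum>m<n. ?P x * ?q x m *
       log 2 (?P x * ?q x m / (?P x * (p * q0 m + (1 - p) * q1 m))))"
    unfolding sum.cartesian_product[symmetric] fst snd J using p
    by (intro sum.cong refl) (auto split: bool.splits)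
  \<comment> \<open>Cancelling the prior inside the logarithm is safe even if it is 0, as it is also
    a factor in front.\<close>
  also have "\<dots> = (\<Sum>x\<in>UNIV. \<Sum>m<n. ?P x * ?q x m *
       log 2 (?q x m / (p * q0 m + (1 - p) * q1 m)))"
    by (intro sum.cong refl) auto
  also have "\<dots> = (\<Sum>m<n. p * q0 m * log 2 (q0 m / (p * q0 m + (1 - p) * q1 m)) +
      (1 - p) * q1 m * log 2 (q1 m / (p * q0 m + (1 - p) * q1 m)))"
    by (simp add: UNIV_bool sum.distrib)
  finally show ?thesis .
qed

end

text \<open>The supremum dominates its members only once the family is known to be bounded above;
  \<open>binary_entropy p\<close> is the bound.\<close>

lemma accessible_information_ge:
  fixes \<rho>0 \<rho>1 :: "complex ^ 'd ^ 'd"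
  assumes p: "0 \<le> p" "p \<le> 1" and \<rho>: "density_operator \<rho>0" "density_operator \<rho>1"
    and "povm n E"
  shows "pmf_mutual_information (measurement_pmf p \<rho>0 \<rho>1 n E) \<le> accessible_information p \<rho>0 \<rho>1"
proof -
  have "bdd_above ((\<lambda>(n, E). pmf_mutual_information (measurement_pmf p \<rho>0 \<rho>1 n E)) ` {(n, E). povm n E})"
  proof (rule bdd_aboveI2[of _ _ "binary_entropy p"], clarify)
    fix n and E :: "nat \<Rightarrow> complex ^ 'd ^ 'd"
    assume E: "povm n E"
    show "pmf_mutual_information (measurement_pmf p \<rho>0 \<rho>1 n E) \<le> binary_entropy p"
      unfolding information_measurement[OF E p \<rho>]
      by (rule information_le) (auto simp: p pmf_outcome[OF E] \<rho> sum_outcomes[OF E] outcome_nonneg[OF E])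
  qed
  from cSUP_upper[OF _ this, of "(n, E)"] \<open>povm n E\<close> show ?thesis
    by (simp add: accessible_information_def)
qed

text \<open>Here \<open>f\<close> is the classical fidelity (Bhattacharyya coefficient) of the two
  outcome distributions.\<close>

lemma accessible_information_ge_fidelity:
  fixes \<rho>0 \<rho>1 :: "complex ^ 'd ^ 'd"
  assumes p: "0 \<le> p" "p \<le> 1" and \<rho>: "density_operator \<rho>0" "density_operator \<rho>1"
    and E: "povm n E"
  defines "f \<equiv> (\<Sum>m<n. sqrt (Re (trace (E m ** \<rho>0)) * Re (trace (E m ** \<rho>1))))"
  shows "accessible_information p \<rho>0 \<rho>1 \<ge> binary_entropy p - 2 * sqrt (p * (1 - p)) * f"
    and "accessible_information p \<rho>0 \<rho>1 \<ge> - log 2 (p\<^sup>2 + (1 - p)\<^sup>2 + 2 * p * (1 - p) * f)"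
proof -
  have f: "f = (\<Sum>m<n. sqrt (pmf (outcome_pmf n E \<rho>0) m * pmf (outcome_pmf n E \<rho>1) m))"
    by (simp add: f_def pmf_outcome[OF E] \<rho>)
  have sums: "(\<Sum>m<n. pmf (outcome_pmf n E \<rho>0) m) = 1" "(\<Sum>m<n. pmf (outcome_pmf n E \<rho>1) m) = 1"
    by (simp_all add: pmf_outcome[OF E] \<rho> sum_outcomes[OF E])
  note le = accessible_information_ge[OF p \<rho> E]
  show "accessible_information p \<rho>0 \<rho>1 \<ge> binary_entropy p - 2 * sqrt (p * (1 - p)) * f"
    by (rule order_trans[OF _ le])
      (unfold f information_measurement[OF E p \<rho>], rule information_ge_binary_entropy[OF p _ _ sums]; simp)
  show "accessible_information p \<rho>0 \<rho>1 \<ge> - log 2 (p\<^sup>2 + (1 - p)\<^sup>2 + 2 * p * (1 - p) * f)"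
    by (rule order_trans[OF _ le])
      (unfold f information_measurement[OF E p \<rho>], rule information_ge_log[OF p _ _ sums]; simp)
qed

section \<open>Measurements attaining the fidelity\<close>

lemma matrix_scaleR_left: "(c *\<^sub>R X) ** Y = c *\<^sub>R (X ** Y)"
  for X :: "complex ^ 'n ^ 'm"
  by (simp add: vec_eq_iff matrix_matrix_mult_def scaleR_sum_right)

lemma matrix_scaleR_right: "X ** (c *\<^sub>R Y) = c *\<^sub>R (X ** Y)"
  for X :: "complex ^ 'n ^ 'm"
  by (simp add: vec_eq_iff matrix_matrix_mult_def scaleR_sum_right)

lemma matrix_add_rdistrib: "(X + Y) ** Z = X ** Z + Y ** Z"
  for X :: "complex ^ 'n ^ 'm"
  by (simp add: vec_eq_iff matrix_matrix_mult_def distrib_right sum.distrib)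

lemma continuous_on_matrix_mult [continuous_intros]:
  fixes f :: "'a::topological_space \<Rightarrow> complex ^ 'n ^ 'm"
  assumes "continuous_on S f" "continuous_on S g"
  shows "continuous_on S (\<lambda>x. f x ** g x)"
  unfolding matrix_matrix_mult_def
  by (intro continuous_intros assms)

lemma continuous_on_cadjoint [continuous_intros]:
  assumes "continuous_on S f"
  shows "continuous_on S (\<lambda>x. cadjoint (f x))"
proof -
  have "(\<lambda>x. cadjoint (f x)) = (\<lambda>x. \<chi> i j. cnj (f x $ j $ i))"
    by (simp add: fun_eq_iff vec_eq_iff)
  then show ?thesis by (simp only:) (intro continuous_intros assms)
qed

text \<open>
  The measurement in the eigenbasis of \<open>M = (B\<^sup>*)\<^sup>-\<^sup>1 (B\<^sup>* \<rho> B)\<^sup>1\<^sup>/\<^sup>2 B\<^sup>-\<^sup>1\<close> attains the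
  fidelity (Fuchs and Caves), because \<open>A = M B\<close>.
\<close>

lemma fidelity_basis_invertible:
  fixes \<rho> B C :: "complex ^ 'd ^ 'd"
  assumes \<rho>: "positive_semidef \<rho>" and C: "B ** C = mat 1" "C ** B = mat 1"
  obtains A V :: "complex ^ 'd ^ 'd" where "A ** cadjoint A = \<rho>" "unitary V"
    "(\<Sum>m\<in>UNIV. norm ((cadjoint V ** A) $ m) * norm ((cadjoint V ** B) $ m)) = A \<bullet> B"
proof -
  have C': "cadjoint C ** cadjoint B = mat 1"
    by (metis C(1) cadjoint_mat_1 cadjoint_mult)
  obtain S where S: "positive_semidef S" and SS: "S ** S = cadjoint B ** \<rho> ** B"
    using positive_semidef_sqrt[OF positive_semidef_congruence[OF \<rho>, of B]] .
  have adj: "cadjoint S = S" using S by (simp add: positive_semidef_iff)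
  \<comment> \<open>This factor of \<open>\<rho>\<close> makes \<open>A ** C\<close> the congruence
    of \<open>S\<close> by \<open>C\<close>, hence positive semidefinite; \<open>V\<close> will be
    its eigenbasis.\<close>
  define A where "A = cadjoint C ** S"
  have "A ** cadjoint A = cadjoint C ** (S ** S) ** C"
    by (simp add: A_def cadjoint_mult adj matrix_mul_assoc)
  also have "\<dots> = (cadjoint C ** cadjoint B) ** \<rho> ** (B ** C)"
    by (simp only: SS matrix_mul_assoc)
  finally have A: "A ** cadjoint A = \<rho>" by (simp add: C C')
  obtain V \<mu> where V: "unitary V" and M: "A ** C = V ** real_diag \<mu> ** cadjoint V" and \<mu>: "\<And>i. 0 \<le> \<mu> i"
    using positive_semidef_diagonalization[OF positive_semidef_congruence[OF S, of C]]
    unfolding A_def by metis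
  have "cadjoint V ** A = (cadjoint V ** V) ** real_diag \<mu> ** (cadjoint V ** B)"
  proof -
    have "A = A ** C ** B" by (simp add: matrix_mul_assoc[symmetric] C)
    then show ?thesis unfolding M by (simp add: matrix_mul_assoc)
  qed
  then have "cadjoint V ** A = real_diag \<mu> ** (cadjoint V ** B)"
    using V by (simp add: unitary_def)
  \<comment> \<open>Corresponding rows are nonnegative multiples of each other, so Cauchy-Schwarz is
    an equality in each row.\<close>
  then have VA: "(cadjoint V ** A) $ m = \<mu> m *\<^sub>R (cadjoint V ** B) $ m" for m
    unfolding vec_eq_iff[of "(cadjoint V ** A) $ m"] vector_scaleR_component
    by (simp add: mult_real_diag_nth scaleR_conv_of_real)
  have "A \<bullet> B = (cadjoint V ** A) \<bullet> (cadjoint V ** B)"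
    by (simp add: inner_unitary_left[OF unitary_cadjoint[OF V]])
  also have "\<dots> = (\<Sum>m\<in>UNIV. (cadjoint V ** A) $ m \<bullet> (cadjoint V ** B) $ m)"
    by (rule inner_vec_def)
  also have "\<dots> = (\<Sum>m\<in>UNIV. norm ((cadjoint V ** A) $ m) * norm ((cadjoint V ** B) $ m))"
    by (intro sum.cong refl) (simp add: VA \<mu> power2_norm_eq_inner[symmetric] power2_eq_square)
  finally show ?thesis using A V that by simp
qed

text \<open>A singular \<open>\<rho>1\<close> is reached as a limit: \<open>D e\<close>, the square
  root of \<open>\<rho>1\<close> plus \<open>e\<close>, is invertible for \<open>e > 0\<close>, and
  compactness provides a limit of the corresponding \<open>A\<close> and \<open>V\<close> as
  \<open>e\<close> tends to 0.\<close>

lemma fidelity_basis: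
  fixes \<rho>0 \<rho>1 :: "complex ^ 'd ^ 'd"
  assumes \<rho>0: "positive_semidef \<rho>0" and \<rho>1: "positive_semidef \<rho>1"
  obtains A B V :: "complex ^ 'd ^ 'd" where "A ** cadjoint A = \<rho>0" "B ** cadjoint B = \<rho>1" "unitary V"
    "(\<Sum>m\<in>UNIV. norm ((cadjoint V ** A) $ m) * norm ((cadjoint V ** B) $ m)) = A \<bullet> B"
proof -
  \<comment> \<open>The defect in the desired equality; being continuous, it stays 0 in the
    limit.\<close>
  define F :: "(complex ^ 'd ^ 'd) \<times> (complex ^ 'd ^ 'd) \<times> (complex ^ 'd ^ 'd) \<Rightarrow> real"
    where "F = (\<lambda>(A, V, B). (\<Sum>m\<in>UNIV. norm ((cadjoint V ** A) $ m) * norm ((cadjoint V ** B) $ m)) - A \<bullet> B)"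
  define T :: "((complex ^ 'd ^ 'd) \<times> (complex ^ 'd ^ 'd)) set"
    \<comment> \<open>Compact, since both equations are closed and fix the norms of \<open>A\<close>
      and \<open>V\<close>.\<close>
    where "T = {(A, V). A ** cadjoint A = \<rho>0 \<and> cadjoint V ** V = mat 1}"
  obtain U :: "complex ^ 'd ^ 'd" and r where U: "unitary U" and \<rho>1_eq: "\<rho>1 = U ** real_diag r ** cadjoint U" and r: "\<And>i. 0 \<le> r i"
    using positive_semidef_diagonalization[OF \<rho>1] by blast
  define D where "D e = U ** real_diag (\<lambda>i. sqrt (r i) + e) ** cadjoint U" for e
  have D: "continuous_on UNIV D"
  proof -
    have "continuous_on UNIV (\<lambda>e. if i = j then complex_of_real (sqrt (r i) + e) else 0)" for i j :: 'd
      by (cases "i = j") (auto intro!: continuous_intros)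
    then show ?thesis unfolding D_def real_diag_def by (intro continuous_intros)
  qed
  have D0: "D 0 ** cadjoint (D 0) = \<rho>1"
  proof -
    have "D 0 ** cadjoint (D 0) = U ** real_diag (sqrt \<circ> r) ** (cadjoint U ** U) ** real_diag (sqrt \<circ> r) ** cadjoint U"
      by (simp add: D_def cadjoint_mult matrix_mul_assoc comp_def)
    also have "\<dots> = U ** (real_diag (sqrt \<circ> r) ** real_diag (sqrt \<circ> r)) ** cadjoint U"
      using U by (simp add: unitary_def matrix_mul_assoc)
    finally show ?thesis by (simp add: real_diag_mult r \<rho>1_eq)
  qed
  have "\<exists>A V. (A, V) \<in> T \<and> F (A, V, D e) = 0" if e: "0 < e" for e
  proof -
    define C where "C = U ** real_diag (\<lambda>i. 1 / (sqrt (r i) + e)) ** cadjoint U"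
    have ne: "sqrt (r i) + e \<noteq> 0" for i using r[of i] e by (smt (verit) real_sqrt_ge_zero)
    have "D e ** C = U ** (real_diag (\<lambda>i. sqrt (r i) + e) ** (cadjoint U ** U) ** real_diag (\<lambda>i. 1 / (sqrt (r i) + e))) ** cadjoint U"
      by (simp add: D_def C_def matrix_mul_assoc)
    also have "\<dots> = mat 1"
      using U ne by (simp add: unitary_def real_diag_mult)
    finally have DC: "D e ** C = mat 1" .
    then have "C ** D e = mat 1" by (simp add: matrix_left_right_inverse)
    with \<rho>0 DC obtain A V where "A ** cadjoint A = \<rho>0" "unitary V"
      "(\<Sum>m\<in>UNIV. norm ((cadjoint V ** A) $ m) * norm ((cadjoint V ** D e) $ m)) = A \<bullet> D e"
      by (rule fidelity_basis_invertible)
    then show ?thesis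
      by (intro exI[of _ A] exI[of _ V]) (simp add: T_def F_def unitary_def)
  qed
  then have "\<exists>Z. Z \<in> T \<and> F (fst Z, snd Z, D (inverse (real (Suc k)))) = 0" for k
  proof -
    obtain A V where "(A, V) \<in> T" "F (A, V, D (inverse (real (Suc k)))) = 0"
      using \<open>\<And>e. 0 < e \<Longrightarrow> \<exists>A V. (A, V) \<in> T \<and> F (A, V, D e) = 0\<close>[of "inverse (real (Suc k))"] by auto
    then show ?thesis by (intro exI[of _ "(A, V)"]) simp
  qed
  then have "\<forall>k. \<exists>Z. Z \<in> T \<and> F (fst Z, snd Z, D (inverse (real (Suc k)))) = 0" by blast
  from choice[OF this] obtain X where X: "\<And>k. X k \<in> T"
    and FX: "\<And>k. F (fst (X k), snd (X k), D (inverse (real (Suc k)))) = 0"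
    by blast
  have "compact T"
  proof -
    have "bounded T"
    proof -
      have "T \<subseteq> cball 0 (sqrt (Re (trace \<rho>0))) \<times> cball 0 (sqrt (Re (trace (mat 1 :: complex ^ 'd ^ 'd))))"
      proof clarsimp
        fix A V assume "(A, V) \<in> T"
        then have "Re (trace \<rho>0) = (norm A)\<^sup>2" "Re (trace (mat 1 :: complex ^ 'd ^ 'd)) = (norm V)\<^sup>2"
          using Re_trace[of A] Re_trace[of "cadjoint V"] by (auto simp: T_def)
        then show "norm A \<le> sqrt (Re (trace \<rho>0)) \<and> norm V \<le> sqrt (Re (trace (mat 1 :: complex ^ 'd ^ 'd)))"
          by simp
      qed
      then show ?thesis by (rule bounded_subset[OF bounded_Times[OF bounded_cball bounded_cball]])
    qed
    moreover have "closed T"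
      unfolding T_def case_prod_unfold
      by (intro closed_Collect_conj closed_Collect_eq continuous_intros)
    ultimately show ?thesis by (simp add: compact_eq_bounded_closed)
  qed
  then obtain Z s where Z: "Z \<in> T" and s: "strict_mono s" "(X \<circ> s) \<longlonglongrightarrow> Z"
    using X unfolding compact_def by metis
  have "(\<lambda>k. inverse (real (Suc (s k)))) \<longlonglongrightarrow> 0"
    using LIMSEQ_subseq_LIMSEQ[OF LIMSEQ_inverse_real_of_nat s(1)] by (simp add: comp_def)
  then have "(\<lambda>k. (fst (X (s k)), snd (X (s k)), inverse (real (Suc (s k))))) \<longlonglongrightarrow> (fst Z, snd Z, 0)"
    using s(2) by (intro tendsto_intros) (auto simp: comp_def)
  then have "(\<lambda>k. (\<lambda>(A, V, e). F (A, V, D e)) (fst (X (s k)), snd (X (s k)), inverse (real (Suc (s k)))))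
      \<longlonglongrightarrow> (\<lambda>(A, V, e). F (A, V, D e)) (fst Z, snd Z, 0)"
  proof (rule continuous_on_tendsto_compose[rotated])
    show "continuous_on UNIV (\<lambda>(A, V, e). F (A, V, D e))"
    unfolding F_def case_prod_unfold
    by (intro continuous_intros continuous_on_compose2[OF D]) auto
  qed auto
  then have "F (fst Z, snd Z, D 0) = 0"
    using LIMSEQ_unique[OF _ tendsto_const[of 0]] by (simp add: FX del: of_nat_Suc)
  then show ?thesis
    using that[of "fst Z" "D 0" "snd Z"] Z D0
    by (auto simp: T_def F_def unitary_def matrix_left_right_inverse)
qed

text \<open>Measuring in the columns of \<open>V\<close> yields outcome probabilities that are
  squared norms of rows of \<open>V\<^sup>* A\<close> and \<open>V\<^sup>* B\<close>, so the
  fidelity is the sum of products of row norms.\<close>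

lemma fidelity_measurement:
  fixes \<rho>0 \<rho>1 :: "complex ^ 'd ^ 'd"
  assumes "positive_semidef \<rho>0" "positive_semidef \<rho>1"
  obtains A B :: "complex ^ 'd ^ 'd" and n E where "A ** cadjoint A = \<rho>0" "B ** cadjoint B = \<rho>1" "povm n E"
    "(\<Sum>m<n. sqrt (Re (trace (E m ** \<rho>0)) * Re (trace (E m ** \<rho>1)))) = A \<bullet> B"
proof -
  obtain A B V :: "complex ^ 'd ^ 'd" where A: "A ** cadjoint A = \<rho>0" and B: "B ** cadjoint B = \<rho>1" and V: "unitary V"
    and AB: "(\<Sum>m\<in>UNIV. norm ((cadjoint V ** A) $ m) * norm ((cadjoint V ** B) $ m)) = A \<bullet> B"
    using fidelity_basis[OF assms] .
  obtain h where h: "bij_betw h {..<CARD('d)} (UNIV :: 'd set)"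
    using ex_bij_betw_nat_finite[of "UNIV :: 'd set"] by (auto simp: atLeast0LessThan)
  \<comment> \<open>\<open>Q k\<close> keeps only column \<open>k\<close> of \<open>V\<close>, so
    \<open>E m\<close> is the rank-one projection onto column \<open>h m\<close>.\<close>
  define Q where "Q k = V ** real_diag (\<lambda>i. if i = k then 1 else 0)" for k
  define E where "E m = Q (h m) ** cadjoint (Q (h m))" for m
  have E_nth: "E m $ i $ j = V $ i $ h m * cnj (V $ j $ h m)" for m i j
    unfolding E_def matrix_matrix_mult_def[of "Q _"]
    by (simp add: Q_def real_diag_mult_nth if_distrib if_distrib[of "\<lambda>z. _ * z"] cong: if_cong)
  have trace: "Re (trace (E m ** (X ** cadjoint X))) = (norm ((cadjoint V ** X) $ h m))\<^sup>2" for m X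
  proof -
    have "Re (trace (E m ** (X ** cadjoint X))) = (cadjoint (Q (h m)) ** X) \<bullet> (cadjoint (Q (h m)) ** X)"
      by (simp add: E_def Re_trace_mult cadjoint_mult inner_mult_left matrix_mul_assoc)
        (metis (no_types, lifting) cadjoint_cadjoint inner_commute inner_mult_left inner_mult_right matrix_mul_assoc)
    also have "cadjoint (Q (h m)) ** X = real_diag (\<lambda>i. if i = h m then 1 else 0) ** (cadjoint V ** X)"
      by (simp add: Q_def cadjoint_mult matrix_mul_assoc)
    also have "\<dots> = (\<chi> i. if i = h m then (cadjoint V ** X) $ i else 0)"
      unfolding vec_eq_iff mult_real_diag_nth by simp
    also have "\<dots> \<bullet> \<dots> = (norm ((cadjoint V ** X) $ h m))\<^sup>2"
      unfolding inner_vec_def[of "\<chi> i. if i = h m then _ i else _"]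
      by (simp add: if_distrib[of "\<lambda>x. x \<bullet> _"] power2_norm_eq_inner cong: if_cong)
    finally show ?thesis .
  qed
  have "(\<Sum>m<CARD('d). E m) = mat 1"
  proof -
    have "(\<Sum>m<CARD('d). E m) $ i $ j = (V ** cadjoint V) $ i $ j" for i j
      using sum.reindex_bij_betw[OF h, of "\<lambda>k. V $ i $ k * cnj (V $ j $ k)"]
      by (simp add: E_nth matrix_matrix_mult_def)
    then show ?thesis using V by (simp add: vec_eq_iff unitary_def)
  qed
  then have "povm CARD('d) E"
    by (simp add: povm_def E_def positive_semidef_square)
  moreover have "(\<Sum>m<CARD('d). sqrt (Re (trace (E m ** \<rho>0)) * Re (trace (E m ** \<rho>1)))) = A \<bullet> B"
    using sum.reindex_bij_betw[OF h, of "\<lambda>k. norm ((cadjoint V ** A) $ k) * norm ((cadjoint V ** B) $ k)"] AB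
    by (simp add: trace A[symmetric] B[symmetric] real_sqrt_mult)
  ultimately show ?thesis using that A B by blast
qed

section \<open>Bounds on the Holevo information\<close>

lemma von_neumann_entropy_diag:
  assumes "unitary U"
  shows "von_neumann_entropy (U ** real_diag l ** cadjoint U) = - (\<Sum>i\<in>UNIV. l i * log 2 (l i))"
proof -
  have "von_neumann_entropy (U ** real_diag l ** cadjoint U) =
      - ((U ** real_diag l ** cadjoint U) \<bullet> (U ** real_diag (log 2 \<circ> l) ** cadjoint U))"
  proof -
    have "cadjoint (U ** real_diag l ** cadjoint U) = U ** real_diag l ** cadjoint U"
      by (simp add: cadjoint_mult matrix_mul_assoc)
    then show ?thesis
      unfolding von_neumann_entropy_def matrix_function_diag[OF assms] Re_trace_mult by simp
  qed
  also have "\<dots> = - (real_diag l \<bullet> real_diag (log 2 \<circ> l))"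
    by (simp only: inner_unitary_right[OF unitary_cadjoint[OF assms]] inner_unitary_left[OF assms])
  also have "real_diag l \<bullet> real_diag (log 2 \<circ> l) = (\<Sum>i\<in>UNIV. l i * log 2 (l i))"
    by (simp add: inner_complex_matrix real_diag_def if_distrib[of "\<lambda>z. _ * z"] if_distrib[of cnj] cong: if_cong)
  finally show ?thesis by simp
qed

text \<open>In the eigenbases of \<open>\<sigma>\<close> and \<open>\<rho>\<close> the equation
  decouples, and entry \<open>(j, i)\<close> of the solution is the overlap times
  \<open>r i / (b j + u * r i)\<close>. The denominator can vanish only if \<open>r i = 0\<close>,
  where the entry 0 is correct.\<close>

lemma resolvent_solution:
  fixes U V :: "complex ^ 'd ^ 'd"
  assumes U: "unitary U" and V: "unitary V" and r: "\<And>i. 0 \<le> r i" and b: "\<And>j. 0 \<le> b j" and u: "0 < u"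
  defines "\<rho> \<equiv> U ** real_diag r ** cadjoint U" and "\<sigma> \<equiv> V ** real_diag b ** cadjoint V"
  obtains Y where "\<sigma> ** Y + u *\<^sub>R (Y ** \<rho>) = \<rho>"
    "Y \<bullet> \<rho> = (\<Sum>j\<in>UNIV. \<Sum>i\<in>UNIV. (cmod ((cadjoint V ** U) $ j $ i))\<^sup>2 * (r i)\<^sup>2 / (b j + u * r i))"
proof -
  define T where "T = cadjoint V ** U"
  define Z where "Z = (\<chi> j i. T $ j $ i * of_real (r i / (b j + u * r i)))"
  define Y where "Y = V ** Z ** cadjoint U"
  have "real_diag b ** Z + u *\<^sub>R (Z ** real_diag r) = T ** real_diag r"
  proof -
    have "complex_of_real (b j) * (T $ j $ i * of_real (r i / (b j + u * r i))) +
        of_real u * (T $ j $ i * of_real (r i / (b j + u * r i)) * of_real (r i)) = T $ j $ i * of_real (r i)" for i j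
    proof -
      have *: "b j * (r i / (b j + u * r i)) + u * ((r i / (b j + u * r i)) * r i) = r i"
        using r[of i] b[of j] u
      proof (cases "r i = 0")
        case False
        then have "0 < u * r i" using r[of i] u by (simp add: less_le)
        then have "b j + u * r i \<noteq> 0" using b[of j] by simp
        then have "(b j + u * r i) * (r i / (b j + u * r i)) = r i" by simp
        then show ?thesis by (simp add: algebra_simps add_divide_distrib)
      qed simp
      have "complex_of_real c * (z * of_real g) + of_real u * (z * of_real g * of_real x) =
          z * of_real (c * g + u * (g * x))" for c g x z
        by (simp add: algebra_simps)
      then show ?thesis by (simp only: *)
    qed
    then show ?thesis
      unfolding vec_eq_iff vector_add_component vector_scaleR_component mult_real_diag_nth real_diag_mult_nth
      by (simp add: Z_def scaleR_conv_of_real)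
  qed
  then have "V ** (real_diag b ** Z + u *\<^sub>R (Z ** real_diag r)) ** cadjoint U = V ** (T ** real_diag r) ** cadjoint U"
    by simp
  moreover have "V ** (T ** real_diag r) ** cadjoint U = \<rho>"
    using V by (simp add: T_def \<rho>_def matrix_mul_assoc unitary_def)
  moreover have "V ** (real_diag b ** Z + u *\<^sub>R (Z ** real_diag r)) ** cadjoint U = \<sigma> ** Y + u *\<^sub>R (Y ** \<rho>)"
  proof -
    have "\<sigma> ** Y = V ** real_diag b ** (cadjoint V ** V) ** Z ** cadjoint U"
      by (simp add: \<sigma>_def Y_def matrix_mul_assoc)
    then have "\<sigma> ** Y = V ** real_diag b ** Z ** cadjoint U"
      using V by (simp add: unitary_def)
    moreover have "Y ** \<rho> = V ** Z ** (cadjoint U ** U) ** real_diag r ** cadjoint U"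
      by (simp add: \<rho>_def Y_def matrix_mul_assoc)
    then have "Y ** \<rho> = V ** Z ** real_diag r ** cadjoint U"
      using U by (simp add: unitary_def)
    ultimately show ?thesis
      by (simp add: matrix_add_ldistrib matrix_add_rdistrib matrix_scaleR_left matrix_scaleR_right matrix_mul_assoc)
  qed
  ultimately have "\<sigma> ** Y + u *\<^sub>R (Y ** \<rho>) = \<rho>" by simp
  moreover have "Y \<bullet> \<rho> = (\<Sum>j\<in>UNIV. \<Sum>i\<in>UNIV. (cmod (T $ j $ i))\<^sup>2 * (r i)\<^sup>2 / (b j + u * r i))"
  proof -
    have "\<rho> = V ** (T ** real_diag r) ** cadjoint U"
      using V by (simp add: T_def \<rho>_def matrix_mul_assoc unitary_def)
    then have "Y \<bullet> \<rho> = Z \<bullet> (T ** real_diag r)"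
      unfolding Y_def by (simp only: inner_unitary_right[OF unitary_cadjoint[OF U]] inner_unitary_left[OF V])
    also have "\<dots> = (\<Sum>j\<in>UNIV. \<Sum>i\<in>UNIV. Z $ j $ i \<bullet> (T $ j $ i * of_real (r i)))"
      by (simp add: inner_vec_def real_diag_mult_nth)
    also have "\<dots> = (\<Sum>j\<in>UNIV. \<Sum>i\<in>UNIV. (cmod (T $ j $ i))\<^sup>2 * (r i)\<^sup>2 / (b j + u * r i))"
      by (intro sum.cong refl)
        (unfold cmod_power2, simp add: Z_def inner_complex_def power2_eq_square add_divide_distrib algebra_simps)
    finally show ?thesis .
  qed
  ultimately show ?thesis using that unfolding T_def by blast
qed

text \<open>Let \<open>G\<close> be the average of the projections onto \<open>a\<close> and
  \<open>b\<close> with weights \<open>p\<close> and \<open>1 - p\<close>. The hypothesis bounds the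
  quadratic form of \<open>G + u\<close> at \<open>y\<close> by \<open>y \<bullet> a\<close>; with
  \<open>(G + u) y0 = a\<close>, nonnegativity of that form at \<open>y - y0\<close> gives
  \<open>y \<bullet> a \<le> y0 \<bullet> a\<close>. On a plane containing \<open>a\<close> and
  \<open>b\<close>, \<open>G\<close> has trace 1 and determinant \<open>d\<close>, whence the
  denominator \<open>u\<^sup>2 + u + d\<close>.\<close>

lemma inner_le_two_vector_resolvent:
  fixes y a b :: "'a::real_inner"
  assumes a: "a \<bullet> a = 1" and b: "b \<bullet> b = 1" and p: "0 \<le> p" "p \<le> 1" and u: "0 < u"
    and le: "p * (y \<bullet> a)\<^sup>2 + (1 - p) * (y \<bullet> b)\<^sup>2 + u * (y \<bullet> y) \<le> y \<bullet> a"
  defines "d \<equiv> p * (1 - p) * (1 - (a \<bullet> b)\<^sup>2)"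
  shows "p * (y \<bullet> a) \<le> (p * u + d) / (u\<^sup>2 + u + d)"
proof -
  define c where "c = a \<bullet> b"
  define D where "D = u\<^sup>2 + u + d"
  have "c\<^sup>2 \<le> 1"
    using Cauchy_Schwarz_ineq[of a b] a b by (simp add: c_def)
  then have "0 \<le> d" using p by (simp add: d_def c_def)
  then have D: "0 < D" using u by (simp add: D_def add_pos_nonneg)
  define \<alpha> \<beta> where "\<alpha> = (1 - p + u) / D" and "\<beta> = - (1 - p) * c / D"
  \<comment> \<open>\<open>y0\<close> solves \<open>p (a \<bullet> y0) a + (1 - p) (b \<bullet> y0) b + u y0 = a\<close>.\<close>
  define y0 where "y0 = \<alpha> *\<^sub>R a + \<beta> *\<^sub>R b"
  define k z where "k = y0 \<bullet> a" and "z = y0 \<bullet> b"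
  have k: "k = \<alpha> + \<beta> * c" and z: "z = \<alpha> * c + \<beta>"
    using a b by (simp_all add: k_def z_def y0_def c_def inner_add_left inner_add_right inner_commute)
  have eq1: "p * k + u * \<alpha> = 1"
  proof -
    have "(p * k + u * \<alpha>) * D = p * ((1 - p + u) - (1 - p) * c * c) + u * (1 - p + u)"
      using D unfolding k \<alpha>_def \<beta>_def by (simp add: field_simps)
    also have "\<dots> = D"
      by (simp add: D_def d_def c_def[symmetric] power2_eq_square algebra_simps)
    finally show ?thesis using D by simp
  qed
  have eq2: "(1 - p) * z + u * \<beta> = 0"
    using D unfolding z \<alpha>_def \<beta>_def by (simp add: field_simps)
  have "0 \<le> p * (y \<bullet> a - k)\<^sup>2 + (1 - p) * (y \<bullet> b - z)\<^sup>2 + u * ((y - y0) \<bullet> (y - y0))"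
    using p u by (intro add_nonneg_nonneg mult_nonneg_nonneg) auto
  also have "(y - y0) \<bullet> (y - y0) = y \<bullet> y - 2 * (\<alpha> * (y \<bullet> a) + \<beta> * (y \<bullet> b)) + (\<alpha> * k + \<beta> * z)"
  proof -
    have "(y - y0) \<bullet> (y - y0) = y \<bullet> y - 2 * (y \<bullet> y0) + y0 \<bullet> y0"
      by (simp add: inner_diff_left inner_diff_right inner_commute)
    moreover have "y0 \<bullet> y0 = \<alpha> * k + \<beta> * z"
      unfolding k_def z_def by (subst (2) y0_def) (simp add: inner_add_right)
    moreover have "y \<bullet> y0 = \<alpha> * (y \<bullet> a) + \<beta> * (y \<bullet> b)"
      by (simp add: y0_def inner_add_right)
    ultimately show ?thesis by simp
  qed
  also have "p * (y \<bullet> a - k)\<^sup>2 + (1 - p) * (y \<bullet> b - z)\<^sup>2 +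
      u * (y \<bullet> y - 2 * (\<alpha> * (y \<bullet> a) + \<beta> * (y \<bullet> b)) + (\<alpha> * k + \<beta> * z)) =
    (p * (y \<bullet> a)\<^sup>2 + (1 - p) * (y \<bullet> b)\<^sup>2 + u * (y \<bullet> y))
      - 2 * (y \<bullet> a) * (p * k + u * \<alpha>) - 2 * (y \<bullet> b) * ((1 - p) * z + u * \<beta>)
      + k * (p * k + u * \<alpha>) + z * ((1 - p) * z + u * \<beta>)"
    by (simp add: power2_eq_square algebra_simps)
  finally have "y \<bullet> a \<le> k" using le by (simp add: eq1 eq2)
  then have "p * (y \<bullet> a) \<le> p * k" using p by (intro mult_left_mono)
  also have "p * k = (p * ((1 - p + u) - (1 - p) * c * c)) / D"
    unfolding k \<alpha>_def \<beta>_def by (simp add: algebra_simps diff_divide_distrib add_divide_distrib)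
  also have "p * ((1 - p + u) - (1 - p) * c * c) = p * u + d"
    by (simp add: d_def c_def[symmetric] power2_eq_square algebra_simps)
  finally show ?thesis by (simp add: D_def)
qed

text \<open>
  The purifications \<open>A\<close>, \<open>B\<close> of the two states reduce the resolvent of the modular operator to
  that of a pure-state ensemble: this is the data processing step.
\<close>

lemma resolvent_bound:
  fixes A B U V :: "complex ^ 'd ^ 'd"
  assumes U: "unitary U" and V: "unitary V" and r: "\<And>i. 0 \<le> r i" and b: "\<And>j. 0 \<le> b j" and u: "0 < u"
    and A: "A ** cadjoint A = U ** real_diag r ** cadjoint U"
    and AB: "p *\<^sub>R (A ** cadjoint A) + (1 - p) *\<^sub>R (B ** cadjoint B) = V ** real_diag b ** cadjoint V"
    and norms: "norm A = 1" "norm B = 1" and p: "0 \<le> p" "p \<le> 1"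
  defines "d \<equiv> p * (1 - p) * (1 - (A \<bullet> B)\<^sup>2)"
  shows "p * (\<Sum>j\<in>UNIV. \<Sum>i\<in>UNIV. (cmod ((cadjoint V ** U) $ j $ i))\<^sup>2 * (r i)\<^sup>2 / (b j + u * r i))
    \<le> (p * u + d) / (u\<^sup>2 + u + d)"
proof -
  obtain Y where Y: "(p *\<^sub>R (A ** cadjoint A) + (1 - p) *\<^sub>R (B ** cadjoint B)) ** Y
      + u *\<^sub>R (Y ** (A ** cadjoint A)) = A ** cadjoint A"
    and k: "Y \<bullet> (A ** cadjoint A) =
      (\<Sum>j\<in>UNIV. \<Sum>i\<in>UNIV. (cmod ((cadjoint V ** U) $ j $ i))\<^sup>2 * (r i)\<^sup>2 / (b j + u * r i))"
    by (rule resolvent_solution[OF U V, of r b u, OF r b u, folded A AB])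
  have quad: "Y \<bullet> (X ** cadjoint X ** Y) = (norm (cadjoint Y ** X))\<^sup>2" for X
  proof -
    have "(norm (cadjoint Y ** X))\<^sup>2 = (norm (cadjoint X ** Y))\<^sup>2"
      by (subst norm_cadjoint[symmetric]) (simp add: cadjoint_mult)
    then show ?thesis
      by (simp add: power2_norm_eq_inner inner_mult_left matrix_mul_assoc)
  qed
  have swap: "(Y ** A) \<bullet> X = (cadjoint Y ** X) \<bullet> A" for X
    by (subst inner_mult_left) (rule inner_commute)
  have Yk: "Y \<bullet> (A ** cadjoint A) = (Y ** A) \<bullet> A"
    by (simp add: inner_mult_right)
  \<comment> \<open>As \<open>A\<close> is a unit vector, Cauchy-Schwarz replaces the quadratic
    forms by inner products with the single vector \<open>Y ** A\<close>: this is the compression to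
    the span of \<open>A\<close> and \<open>B\<close>.\<close>
  have le: "((Y ** A) \<bullet> X)\<^sup>2 \<le> (norm (cadjoint Y ** X))\<^sup>2" for X
    using Cauchy_Schwarz_ineq[of "cadjoint Y ** X" A] norms
    by (simp add: swap power2_norm_eq_inner[symmetric])
  \<comment> \<open>Pairing the equation for \<open>Y\<close> with \<open>Y\<close> itself leads to
    the hypothesis of the two-vector bound for \<open>y = Y ** A\<close>.\<close>
  have "Y \<bullet> (A ** cadjoint A) = p * (Y \<bullet> (A ** cadjoint A ** Y)) + (1 - p) * (Y \<bullet> (B ** cadjoint B ** Y))
      + u * (Y \<bullet> (Y ** (A ** cadjoint A)))"
    by (subst (1) Y[symmetric])
      (simp add: matrix_add_rdistrib matrix_scaleR_left inner_add_right)
  also have "Y \<bullet> (Y ** (A ** cadjoint A)) = (Y ** A) \<bullet> (Y ** A)"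
    by (simp add: inner_mult_right matrix_mul_assoc)
  also have "p * (Y \<bullet> (A ** cadjoint A ** Y)) + (1 - p) * (Y \<bullet> (B ** cadjoint B ** Y)) + u * ((Y ** A) \<bullet> (Y ** A))
      \<ge> p * ((Y ** A) \<bullet> A)\<^sup>2 + (1 - p) * ((Y ** A) \<bullet> B)\<^sup>2 + u * ((Y ** A) \<bullet> (Y ** A))"
    unfolding quad using p u le by (intro add_mono mult_left_mono) auto
  finally have "p * ((Y ** A) \<bullet> A)\<^sup>2 + (1 - p) * ((Y ** A) \<bullet> B)\<^sup>2 + u * ((Y ** A) \<bullet> (Y ** A)) \<le> (Y ** A) \<bullet> A"
    by (simp only: Yk)
  from inner_le_two_vector_resolvent[OF _ _ p u this] norms show ?thesis
    unfolding d_def k[symmetric] Yk by (simp add: norm_eq_1)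
qed

text \<open>
  \<open>b\<close> and \<open>r x\<close> are the spectra of the average state and of \<open>\<rho>\<^sub>x\<close>, and \<open>w x j i\<close> are the squared
  overlaps of the eigenvectors; \<open>r x i * w x j i\<close> and \<open>b j * w x j i\<close> are the classical
  distributions of Nussbaum and Szkola.
\<close>

lemma holevo_information_spectral:
  fixes A B :: "complex ^ 'd ^ 'd" and p :: real
  assumes p: "0 \<le> p" "p \<le> 1" and norms: "norm A = 1" "norm B = 1"
  defines "P \<equiv> \<lambda>x. if x then 1 - p else p" and "d \<equiv> p * (1 - p) * (1 - (A \<bullet> B)\<^sup>2)"
  obtains b :: "'d \<Rightarrow> real" and r :: "bool \<Rightarrow> 'd \<Rightarrow> real" and w :: "bool \<Rightarrow> 'd \<Rightarrow> 'd \<Rightarrow> real"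
  where "\<And>j. 0 \<le> b j" "\<And>x i. 0 \<le> r x i" "\<And>x j i. 0 \<le> w x j i"
    "\<And>x j. (\<Sum>i\<in>UNIV. w x j i) = 1" "\<And>x i. (\<Sum>j\<in>UNIV. w x j i) = 1"
    "\<And>j. b j = (\<Sum>x\<in>UNIV. \<Sum>i\<in>UNIV. P x * r x i * w x j i)" "(\<Sum>j\<in>UNIV. b j) = 1"
    "holevo_information p (A ** cadjoint A) (B ** cadjoint B) =
      (\<Sum>x\<in>UNIV. P x * (\<Sum>i\<in>UNIV. r x i * log 2 (r x i))) - (\<Sum>j\<in>UNIV. b j * log 2 (b j))"
    "\<And>u. 0 < u \<Longrightarrow> (\<Sum>x\<in>UNIV. P x * (\<Sum>j\<in>UNIV. \<Sum>i\<in>UNIV. w x j i * (r x i)\<^sup>2 / (b j + u * r x i)))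
      \<le> (u + 2 * d) / (u\<^sup>2 + u + d)"
proof -
  let ?A = "A ** cadjoint A" and ?B = "B ** cadjoint B"
  have psd: "positive_semidef (p *\<^sub>R ?A + (1 - p) *\<^sub>R ?B)"
  proof -
    have "v \<bullet> ((p *\<^sub>R ?A + (1 - p) *\<^sub>R ?B) *v v) = p * (v \<bullet> (?A *v v)) + (1 - p) * (v \<bullet> (?B *v v))" for v
    proof -
      have "(c *\<^sub>R M) *v v = c *\<^sub>R (M *v v)" for c and M :: "complex ^ 'd ^ 'd"
        by (simp add: vec_eq_iff matrix_vector_mult_def scaleR_sum_right)
      then show ?thesis by (simp add: matrix_vector_mult_add_rdistrib inner_add_right)
    qed
    moreover have "cadjoint (p *\<^sub>R ?A + (1 - p) *\<^sub>R ?B) = p *\<^sub>R cadjoint ?A + (1 - p) *\<^sub>R cadjoint ?B"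
      by (simp add: vec_eq_iff)
    ultimately show ?thesis
      using positive_semidef_square[of A] positive_semidef_square[of B] p
      by (simp add: positive_semidef_iff)
  qed
  obtain V b where V: "unitary V" and bV: "p *\<^sub>R ?A + (1 - p) *\<^sub>R ?B = V ** real_diag b ** cadjoint V"
    and b: "\<And>j. 0 \<le> b j"
    using positive_semidef_diagonalization[OF psd] by blast
  obtain UA rA where UA: "unitary UA" and rUA: "?A = UA ** real_diag rA ** cadjoint UA"
    and rA: "\<And>j. 0 \<le> rA j"
    using positive_semidef_diagonalization[OF positive_semidef_square[of A]] by blast
  obtain UB rB where UB: "unitary UB" and rUB: "?B = UB ** real_diag rB ** cadjoint UB"
    and rB: "\<And>j. 0 \<le> rB j"
    using positive_semidef_diagonalization[OF positive_semidef_square[of B]] by blast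
  define r where "r x = (if x then rB else rA)" for x
  define T where "T x = cadjoint V ** (if x then UB else UA)" for x
  define w where "w x j i = (cmod (T x $ j $ i))\<^sup>2" for x j i
  have T: "unitary (T x)" for x
    using unitary_mult[OF unitary_cadjoint[OF V]] UA UB by (simp add: T_def)
  have sumw: "(\<Sum>i\<in>UNIV. w x j i) = 1" "(\<Sum>j\<in>UNIV. w x j i) = 1" for x i j
    unfolding w_def by (simp_all add: unitary_row_sum[OF T] unitary_column_sum[OF T])
  \<comment> \<open>Diagonal entries of the average state in its own eigenbasis
    \<open>V\<close>.\<close>
  have beq: "b j = (\<Sum>x\<in>UNIV. \<Sum>i\<in>UNIV. P x * r x i * w x j i)" for j
  proof -
    have "real_diag b = cadjoint V ** (p *\<^sub>R ?A + (1 - p) *\<^sub>R ?B) ** V"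
      using V unfolding bV unitary_def by (metis matrix_mul_assoc matrix_mul_lid matrix_mul_rid)
    also have "\<dots> = p *\<^sub>R (T False ** real_diag (r False) ** cadjoint (T False))
        + (1 - p) *\<^sub>R (T True ** real_diag (r True) ** cadjoint (T True))"
      by (simp add: rUA rUB T_def r_def cadjoint_mult matrix_add_ldistrib matrix_add_rdistrib
          matrix_scaleR_left matrix_scaleR_right matrix_mul_assoc)
    finally have "Re (real_diag b $ j $ j) = Re ((p *\<^sub>R (T False ** real_diag (r False) ** cadjoint (T False))
        + (1 - p) *\<^sub>R (T True ** real_diag (r True) ** cadjoint (T True))) $ j $ j)" by simp
    moreover have "Re ((T x ** real_diag (r x) ** cadjoint (T x)) $ j $ j) = (\<Sum>i\<in>UNIV. r x i * w x j i)" for x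
      unfolding matrix_matrix_mult_def[of "T x ** real_diag (r x)"]
      by (simp add: real_diag_mult_nth w_def cmod_power2, simp add: power2_eq_square algebra_simps)
    ultimately show ?thesis
      by (simp add: UNIV_bool P_def real_diag_def sum_distrib_left mult_ac)
  qed
  have sumr: "(\<Sum>i\<in>UNIV. r x i) = 1" for x
  proof -
    have tr: "(\<Sum>i\<in>UNIV. l i) = (norm X)\<^sup>2"
      if "unitary U" "X ** cadjoint X = U ** real_diag l ** cadjoint U" for U X :: "complex ^ 'd ^ 'd" and l
    proof -
      have "(norm X)\<^sup>2 = Re (trace (U ** (real_diag l ** cadjoint U)))"
        by (simp add: Re_trace[symmetric] that(2) matrix_mul_assoc)
      also have "\<dots> = Re (trace (real_diag l))"
        using that(1) by (simp add: trace_mul_sym[of U] unitary_def matrix_mul_assoc[symmetric])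
      also have "\<dots> = (\<Sum>i\<in>UNIV. l i)" by (simp add: trace_def real_diag_def)
      finally show ?thesis by simp
    qed
    show ?thesis using tr[OF UA rUA] tr[OF UB rUB] norms by (simp add: r_def)
  qed
  have sumb: "(\<Sum>j\<in>UNIV. b j) = 1"
  proof -
    have "(\<Sum>j\<in>UNIV. b j) = (\<Sum>x\<in>UNIV. \<Sum>j\<in>UNIV. \<Sum>i\<in>UNIV. P x * r x i * w x j i)"
      unfolding beq by (rule sum.swap)
    also have "\<dots> = (\<Sum>x\<in>UNIV. \<Sum>i\<in>UNIV. \<Sum>j\<in>UNIV. P x * r x i * w x j i)"
      by (rule sum.cong[OF refl], rule sum.swap)
    also have "\<dots> = 1"
      by (simp add: sum_distrib_left[symmetric] sumw sumr P_def UNIV_bool)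
    finally show ?thesis .
  qed
  have chi: "holevo_information p ?A ?B =
      (\<Sum>x\<in>UNIV. P x * (\<Sum>i\<in>UNIV. r x i * log 2 (r x i))) - (\<Sum>j\<in>UNIV. b j * log 2 (b j))"
    unfolding holevo_information_def bV von_neumann_entropy_diag[OF V]
    unfolding rUA rUB von_neumann_entropy_diag[OF UA] von_neumann_entropy_diag[OF UB]
    by (simp add: UNIV_bool P_def r_def)
  have resolvent: "(\<Sum>x\<in>UNIV. P x * (\<Sum>j\<in>UNIV. \<Sum>i\<in>UNIV. w x j i * (r x i)\<^sup>2 / (b j + u * r x i)))
      \<le> (u + 2 * d) / (u\<^sup>2 + u + d)" if u: "0 < u" for u
  proof -
    have "p * (\<Sum>j\<in>UNIV. \<Sum>i\<in>UNIV. w False j i * (r False i)\<^sup>2 / (b j + u * r False i))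
        \<le> (p * u + d) / (u\<^sup>2 + u + d)"
      using resolvent_bound[OF UA V rA b u rUA bV norms p] by (simp add: w_def T_def r_def d_def)
    \<comment> \<open>The roles of \<open>A\<close> and \<open>B\<close> are exchanged and
      \<open>p\<close> becomes \<open>1 - p\<close>; \<open>d\<close> is symmetric under
      this.\<close>
    moreover have "(1 - p) * (\<Sum>j\<in>UNIV. \<Sum>i\<in>UNIV. w True j i * (r True i)\<^sup>2 / (b j + u * r True i))
        \<le> ((1 - p) * u + d) / (u\<^sup>2 + u + d)"
      using resolvent_bound[OF UB V rB b u rUB, of "1 - p" A] bV norms p
      by (simp add: w_def T_def r_def d_def add.commute inner_commute mult_ac)
    moreover have "(p * u + d) / (u\<^sup>2 + u + d) + ((1 - p) * u + d) / (u\<^sup>2 + u + d) = (u + 2 * d) / (u\<^sup>2 + u + d)"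
      by (simp add: add_divide_distrib[symmetric] algebra_simps)
    ultimately show ?thesis by (simp add: UNIV_bool P_def)
  qed
  show ?thesis
    by (rule that[of b r w])
      (use b rA rB sumw beq sumb chi resolvent in \<open>auto simp: r_def w_def\<close>)
qed

text \<open>\<open>\<chi>\<close> is a classical relative entropy,
  \<open>- (\<Sum>k. m k * ln (t k)) / ln 2\<close>. Its sign follows from
  \<open>ln t \<le> t - 1\<close>; for the upper bound the resolvent sums are compared with those of
  a two-point spectrum \<open>l\<close>, \<open>1 - l\<close>, the pure-state case.\<close>

theorem holevo_information_bounds:
  fixes A B :: "complex ^ 'd ^ 'd" and p :: real
  assumes p: "0 \<le> p" "p \<le> 1" and norms: "norm A = 1" "norm B = 1"
  shows "0 \<le> holevo_information p (A ** cadjoint A) (B ** cadjoint B)"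
    and "holevo_information p (A ** cadjoint A) (B ** cadjoint B) \<le>
      2 * sqrt (p * (1 - p) * (1 - (A \<bullet> B)\<^sup>2))"
proof -
  define d where "d = p * (1 - p) * (1 - (A \<bullet> B)\<^sup>2)"
  define P where "P x = (if x then 1 - p else p)" for x
  have P: "0 \<le> P x" for x using p by (simp add: P_def)
  obtain b :: "'d \<Rightarrow> real" and r :: "bool \<Rightarrow> 'd \<Rightarrow> real" and w :: "bool \<Rightarrow> 'd \<Rightarrow> 'd \<Rightarrow> real"
  where b: "\<And>j. 0 \<le> b j" and r: "\<And>x i. 0 \<le> r x i" and w: "\<And>x j i. 0 \<le> w x j i"
    and sumw: "\<And>x j. (\<Sum>i\<in>UNIV. w x j i) = 1" "\<And>x i. (\<Sum>j\<in>UNIV. w x j i) = 1"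
    and beq: "\<And>j. b j = (\<Sum>x\<in>UNIV. \<Sum>i\<in>UNIV. P x * r x i * w x j i)" and sumb: "(\<Sum>j\<in>UNIV. b j) = 1"
    and chi: "holevo_information p (A ** cadjoint A) (B ** cadjoint B) =
      (\<Sum>x\<in>UNIV. P x * (\<Sum>i\<in>UNIV. r x i * log 2 (r x i))) - (\<Sum>j\<in>UNIV. b j * log 2 (b j))"
    and resolvent: "\<And>u. 0 < u \<Longrightarrow>
      (\<Sum>x\<in>UNIV. P x * (\<Sum>j\<in>UNIV. \<Sum>i\<in>UNIV. w x j i * (r x i)\<^sup>2 / (b j + u * r x i)))
        \<le> (u + 2 * d) / (u\<^sup>2 + u + d)"
    using holevo_information_spectral[OF p norms] unfolding d_def P_def by blast
  \<comment> \<open>\<open>m\<close> is a probability distribution on triples, and \<open>t\<close>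
    is the ratio of the Nussbaum-Szkola distributions.\<close>
  define m where "m = (\<lambda>(x, j, i). P x * r x i * w x j i)"
  define t where "t = (\<lambda>(x, j, i). b j / r x i)"
  have triple: "(\<Sum>k\<in>UNIV. f k) = (\<Sum>x\<in>UNIV. \<Sum>j\<in>UNIV. \<Sum>i\<in>UNIV. f (x, j, i))"
    for f :: "bool \<times> 'd \<times> 'd \<Rightarrow> real"
    by (simp add: sum.cartesian_product UNIV_Times_UNIV[symmetric] del: UNIV_Times_UNIV)
  have pos: "0 < b j" "0 < r x i" if "m (x, j, i) \<noteq> 0" for x j i
  proof -
    have "0 < m (x, j, i)" using that P r w by (simp add: m_def less_le)
    also have "m (x, j, i) \<le> (\<Sum>i\<in>UNIV. P x * r x i * w x j i)"
      unfolding m_def prod.case by (rule member_le_sum) (auto simp: P r w)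
    also have "\<dots> \<le> b j"
      unfolding beq by (rule member_le_sum) (auto simp: P r w intro!: sum_nonneg)
    finally show "0 < b j" .
    show "0 < r x i" using that r[of x i] by (auto simp: m_def less_le)
  qed
  have m: "0 \<le> m k" for k by (cases k) (simp add: m_def P r w)
  have total: "(\<Sum>k\<in>UNIV. m k) = 1"
  proof -
    have "(\<Sum>k\<in>UNIV. m k) = (\<Sum>j\<in>UNIV. b j)"
      unfolding triple beq m_def prod.case by (rule sum.swap)
    then show ?thesis by (simp add: sumb)
  qed
  have chi_sum: "holevo_information p (A ** cadjoint A) (B ** cadjoint B) = - (\<Sum>k\<in>UNIV. m k * ln (t k)) / ln 2"
  proof -
    have "(\<Sum>k\<in>UNIV. m k * ln (t k)) =
        (\<Sum>x\<in>UNIV. \<Sum>j\<in>UNIV. \<Sum>i\<in>UNIV. m (x, j, i) * ln (b j) - m (x, j, i) * ln (r x i))"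
      unfolding triple
    proof (intro sum.cong refl)
      fix x j i
      show "m (x, j, i) * ln (t (x, j, i)) = m (x, j, i) * ln (b j) - m (x, j, i) * ln (r x i)"
        using pos[of x j i] by (cases "m (x, j, i) = 0") (auto simp: t_def ln_div right_diff_distrib)
    qed
    also have "\<dots> = (\<Sum>x\<in>UNIV. \<Sum>j\<in>UNIV. \<Sum>i\<in>UNIV. m (x, j, i) * ln (b j))
        - (\<Sum>x\<in>UNIV. \<Sum>j\<in>UNIV. \<Sum>i\<in>UNIV. m (x, j, i) * ln (r x i))"
      by (simp add: sum_subtractf)
    also have "(\<Sum>x\<in>UNIV. \<Sum>j\<in>UNIV. \<Sum>i\<in>UNIV. m (x, j, i) * ln (b j)) = (\<Sum>j\<in>UNIV. b j * ln (b j))"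
    proof -
      have "(\<Sum>x\<in>UNIV. \<Sum>j\<in>UNIV. \<Sum>i\<in>UNIV. m (x, j, i) * ln (b j)) =
          (\<Sum>j\<in>UNIV. \<Sum>x\<in>UNIV. \<Sum>i\<in>UNIV. m (x, j, i) * ln (b j))"
        by (rule sum.swap)
      also have "\<dots> = (\<Sum>j\<in>UNIV. (\<Sum>x\<in>UNIV. \<Sum>i\<in>UNIV. m (x, j, i)) * ln (b j))"
        by (simp only: sum_distrib_right)
      finally show ?thesis by (simp only: m_def prod.case beq[symmetric])
    qed
    also have "(\<Sum>x\<in>UNIV. \<Sum>j\<in>UNIV. \<Sum>i\<in>UNIV. m (x, j, i) * ln (r x i)) =
        (\<Sum>x\<in>UNIV. P x * (\<Sum>i\<in>UNIV. r x i * ln (r x i)))"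
    proof (rule sum.cong[OF refl])
      fix x
      have "(\<Sum>j\<in>UNIV. \<Sum>i\<in>UNIV. m (x, j, i) * ln (r x i)) =
          (\<Sum>i\<in>UNIV. \<Sum>j\<in>UNIV. P x * r x i * ln (r x i) * w x j i)"
        unfolding m_def prod.case by (subst sum.swap) (simp add: mult_ac)
      also have "\<dots> = P x * (\<Sum>i\<in>UNIV. r x i * ln (r x i))"
        by (simp add: sum_distrib_left[symmetric] sumw mult.assoc)
      finally show "(\<Sum>j\<in>UNIV. \<Sum>i\<in>UNIV. m (x, j, i) * ln (r x i)) = P x * (\<Sum>i\<in>UNIV. r x i * ln (r x i))" .
    qed
    finally show ?thesis
      unfolding chi
      by (simp add: log_def sum_divide_distrib[symmetric] diff_divide_distrib)
  qed
  have "(\<Sum>k\<in>UNIV. m k * ln (t k)) \<le> 0"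
  proof -
    have "(\<Sum>k\<in>UNIV. m k * ln (t k)) \<le> (\<Sum>(x, j, i)\<in>UNIV. P x * b j * w x j i - m (x, j, i))"
    proof (intro sum_mono, clarify)
      fix x j i
      show "m (x, j, i) * ln (t (x, j, i)) \<le> P x * b j * w x j i - m (x, j, i)"
      proof (cases "m (x, j, i) = 0")
        case False
        then have *: "0 < t (x, j, i)" using pos by (simp add: t_def)
        have "m (x, j, i) * ln (t (x, j, i)) \<le> m (x, j, i) * (t (x, j, i) - 1)"
          using m by (intro mult_left_mono ln_le_minus_one[OF *])
        also have "m (x, j, i) * t (x, j, i) = P x * b j * w x j i"
          using pos[OF False] by (simp add: m_def t_def)
        then have "m (x, j, i) * (t (x, j, i) - 1) = P x * b j * w x j i - m (x, j, i)"
          by (simp add: right_diff_distrib)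
        finally show ?thesis .
      qed (simp add: P b w)
    qed
    also have "\<dots> = (\<Sum>x\<in>UNIV. \<Sum>j\<in>UNIV. \<Sum>i\<in>UNIV. P x * b j * w x j i) - (\<Sum>k\<in>UNIV. m k)"
      unfolding triple by (simp add: sum_subtractf)
    also have "(\<Sum>x\<in>UNIV. \<Sum>j\<in>UNIV. \<Sum>i\<in>UNIV. P x * b j * w x j i) = 1"
      by (simp add: sum_distrib_left[symmetric] sumw sumb UNIV_bool P_def)
    finally show ?thesis by (simp add: total)
  qed
  then show "0 \<le> holevo_information p (A ** cadjoint A) (B ** cadjoint B)"
    unfolding chi_sum by (simp add: divide_nonpos_pos)
  have "0 \<le> (A \<bullet> B)\<^sup>2" "(A \<bullet> B)\<^sup>2 \<le> 1"
    using Cauchy_Schwarz_ineq[of A B] norms by (auto simp: norm_eq_1)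
  then have d: "0 \<le> d" "d \<le> 1 / 4"
  proof -
    assume *: "0 \<le> (A \<bullet> B)\<^sup>2" "(A \<bullet> B)\<^sup>2 \<le> 1"
    show "0 \<le> d" using * p by (simp add: d_def)
    have "0 \<le> (p - 1 / 2)\<^sup>2" by simp
    then have "p * (1 - p) \<le> 1 / 4" by (simp add: power2_eq_square algebra_simps)
    moreover have "d \<le> p * (1 - p) * 1" unfolding d_def using * p by (intro mult_left_mono) auto
    ultimately show "d \<le> 1 / 4" by simp
  qed
  \<comment> \<open>The larger root of \<open>l * (1 - l) = d\<close>, real because
    \<open>d \<le> 1 / 4\<close>.\<close>
  define l where "l = (1 + sqrt (1 - 4 * d)) / 2"
  have l: "0 < l" "l \<le> 1" using d by (auto simp: l_def add_pos_nonneg)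
  have ll: "l * (1 - l) = d"
  proof -
    have "l * (1 - l) = (1 - (sqrt (1 - 4 * d))\<^sup>2) / 4"
      by (simp add: l_def power2_eq_square field_simps)
    then show ?thesis using d by simp
  qed
  \<comment> \<open>Weights and points coincide, so the comparison sum is minus an entropy; if
    \<open>1 - l\<close> is 0, so is its weight.\<close>
  let ?n = "\<lambda>x::bool. if x then 1 - l else l"
  have "(\<Sum>k\<in>UNIV. ?n k * ln (?n k)) \<le> (\<Sum>k\<in>UNIV. m k * ln (t k))"
  proof (rule sum_ln_mono_if_resolvent_mono)
    show "0 < t k" if "m k \<noteq> 0" for k
      using that pos by (cases k) (simp add: t_def)
    show "0 < ?n k" if "?n k \<noteq> 0" for k
      using that l by (auto split: if_splits)
    show "(\<Sum>k\<in>UNIV. m k) = (\<Sum>k\<in>UNIV. ?n k)" by (simp add: total UNIV_bool)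
    fix u :: real assume u: "0 < u"
    have "(\<Sum>k\<in>UNIV. m k / (t k + u)) =
        (\<Sum>x\<in>UNIV. P x * (\<Sum>j\<in>UNIV. \<Sum>i\<in>UNIV. w x j i * (r x i)\<^sup>2 / (b j + u * r x i)))"
      unfolding triple sum_distrib_left
    proof (intro sum.cong refl)
      fix x j i
      show "m (x, j, i) / (t (x, j, i) + u) = P x * (w x j i * (r x i)\<^sup>2 / (b j + u * r x i))"
      proof (cases "r x i = 0")
        case False
        then have "t (x, j, i) + u = (b j + u * r x i) / r x i"
          by (simp add: t_def add_divide_distrib)
        then show ?thesis using False by (simp add: m_def power2_eq_square)
      qed (simp add: m_def)
    qed
    also have "\<dots> \<le> (u + 2 * d) / (u\<^sup>2 + u + d)" by (rule resolvent[OF u])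
    also have "\<dots> = (\<Sum>k\<in>UNIV. ?n k / (?n k + u))"
    proof -
      have pos: "0 < l + u" "0 < 1 - l + u" using l u by auto
      \<comment> \<open>By partial fractions the bound is exactly the resolvent sum of the two-point
        spectrum.\<close>
      have "u\<^sup>2 + u + d = (l + u) * (1 - l + u)"
        unfolding ll[symmetric] by (simp add: power2_eq_square algebra_simps)
      moreover have "u + 2 * d = l * (1 - l + u) + (1 - l) * (l + u)"
        unfolding ll[symmetric] by (simp add: algebra_simps)
      ultimately show ?thesis
        using pos by (simp add: UNIV_bool add_divide_distrib)
    qed
    finally show "(\<Sum>k\<in>UNIV. m k / (t k + u)) \<le> (\<Sum>k\<in>UNIV. ?n k / (?n k + u))" .
  qed auto
  then have "holevo_information p (A ** cadjoint A) (B ** cadjoint B) \<le> - (\<Sum>k\<in>UNIV. ?n k * ln (?n k)) / ln 2"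
    unfolding chi_sum by (intro divide_right_mono) auto
  also have "\<dots> = binary_entropy l"
    by (simp add: UNIV_bool binary_entropy_def log_def diff_divide_distrib add_divide_distrib)
  also have "\<dots> \<le> 2 * sqrt (l * (1 - l))"
    using l by (intro binary_entropy_le_sqrt) auto
  finally show "holevo_information p (A ** cadjoint A) (B ** cadjoint B) \<le>
      2 * sqrt (p * (1 - p) * (1 - (A \<bullet> B)\<^sup>2))"
    by (simp add: ll d_def)
qed

section \<open>Lower bounds on the accessible information\<close>

theorem theorem1p1:
  fixes p :: real and \<rho>0 \<rho>1 :: "complex ^ 'd ^ 'd"
  assumes "0 \<le> p" and "p \<le> 1"
    and "density_operator \<rho>0" and "density_operator \<rho>1"
  shows "accessible_information p \<rho>0 \<rho>1 \<ge>
           binary_entropy p - sqrt (4 * p * (1 - p) - (holevo_information p \<rho>0 \<rho>1)\<^sup>2) \<and>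
         accessible_information p \<rho>0 \<rho>1 \<ge>
           - log 2 (p\<^sup>2 + (1 - p)\<^sup>2 + (if p \<in> {0, 1} then 0 else
               2 * p * (1 - p) * sqrt (1 - (holevo_information p \<rho>0 \<rho>1)\<^sup>2 / (4 * p * (1 - p)))))"
proof -
  note p = assms(1,2) and \<rho> = assms(3,4)
  let ?\<chi> = "holevo_information p \<rho>0 \<rho>1"
  \<comment> \<open>The same \<open>A\<close> and \<open>B\<close> serve twice: they bound
    \<open>\<chi>\<close> as purifications, and their inner product is the fidelity attained by
    \<open>E\<close>.\<close>
  obtain A B :: "complex ^ 'd ^ 'd" and n E
    where A: "A ** cadjoint A = \<rho>0" and B: "B ** cadjoint B = \<rho>1" and E: "povm n E"
    and AB: "(\<Sum>m<n. sqrt (Re (trace (E m ** \<rho>0)) * Re (trace (E m ** \<rho>1)))) = A \<bullet> B"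
    using fidelity_measurement[of \<rho>0 \<rho>1] \<rho> unfolding density_operator_def by blast
  define f where "f = A \<bullet> B"
  have norms: "norm A = 1" "norm B = 1"
    using Re_trace[of A] Re_trace[of B] \<rho> by (auto simp: A B density_operator_def power2_eq_1_iff)
      (smt (verit) norm_ge_zero)+
  have f0: "0 \<le> f"
    unfolding f_def AB[symmetric] using outcome_nonneg[OF E] \<rho> by (intro sum_nonneg) auto
  note ge = accessible_information_ge_fidelity[OF p \<rho> E, unfolded AB, folded f_def]
  have \<chi>: "0 \<le> ?\<chi>" "?\<chi> \<le> 2 * sqrt (p * (1 - p) * (1 - f\<^sup>2))"
    using holevo_information_bounds[OF p norms] unfolding A B f_def by auto
  have "f\<^sup>2 \<le> 1"
    using Cauchy_Schwarz_ineq[of A B] norms by (auto simp: norm_eq_1 f_def)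
  then have "0 \<le> p * (1 - p) * (1 - f\<^sup>2)" using p by simp
  \<comment> \<open>Squaring needs \<open>0 \<le> ?\<chi>\<close>. Both claims now follow by solving
    this inequality for \<open>f\<close> and inserting the result into the two bounds
    \<open>ge\<close>.\<close>
  with power_mono[OF \<chi>(2,1), of 2] have *: "?\<chi>\<^sup>2 \<le> 4 * (p * (1 - p) * (1 - f\<^sup>2))"
    by (simp add: power_mult_distrib)
  have "2 * sqrt (p * (1 - p)) * f \<le> sqrt (4 * p * (1 - p) - ?\<chi>\<^sup>2)"
  proof (rule real_le_rsqrt)
    have "(2 * sqrt (p * (1 - p)) * f)\<^sup>2 = 4 * (p * (1 - p)) * f\<^sup>2"
      using p by (simp add: power_mult_distrib)
    then show "(2 * sqrt (p * (1 - p)) * f)\<^sup>2 \<le> 4 * p * (1 - p) - ?\<chi>\<^sup>2"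
      using * by (simp add: algebra_simps)
  qed
  then have first: "accessible_information p \<rho>0 \<rho>1 \<ge> binary_entropy p - sqrt (4 * p * (1 - p) - ?\<chi>\<^sup>2)"
    using ge(1) by linarith
  \<comment> \<open>Monotonicity of \<open>log\<close> needs its smaller argument to be
    positive.\<close>
  have pos: "0 < p\<^sup>2 + (1 - p)\<^sup>2" by (auto simp: sum_power2_gt_zero_iff)
  have "2 * p * (1 - p) * f \<le> (if p \<in> {0, 1} then 0 else
               2 * p * (1 - p) * sqrt (1 - ?\<chi>\<^sup>2 / (4 * p * (1 - p))))"
  proof (cases "p \<in> {0, 1}")
    case False
    then have "0 < p" "p < 1" using p by auto
    then have p4: "0 < 4 * p * (1 - p)" by simp
    have "f \<le> sqrt (1 - ?\<chi>\<^sup>2 / (4 * p * (1 - p)))"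
    proof (rule real_le_rsqrt)
      have "?\<chi>\<^sup>2 / (4 * p * (1 - p)) \<le> 1 - f\<^sup>2"
        unfolding pos_divide_le_eq[OF p4] using * by (simp add: algebra_simps)
      then show "f\<^sup>2 \<le> 1 - ?\<chi>\<^sup>2 / (4 * p * (1 - p))" by simp
    qed
    then show ?thesis using False p by (simp add: mult_left_mono)
  qed auto
  then have "log 2 (p\<^sup>2 + (1 - p)\<^sup>2 + 2 * p * (1 - p) * f) \<le>
      log 2 (p\<^sup>2 + (1 - p)\<^sup>2 + (if p \<in> {0, 1} then 0 else
               2 * p * (1 - p) * sqrt (1 - ?\<chi>\<^sup>2 / (4 * p * (1 - p)))))"
    using add_pos_nonneg[OF pos, of "2 * p * (1 - p) * f"] f0 p by (intro log_mono add_left_mono) auto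
  with ge(2) first show ?thesis by linarith
qed

end
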